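(* Let $1<p<\infty$ and $\alpha>-1$. Assume that $f=h+\overline{g}$ belongs to the weighted harmonic Bergman space $a_\alpha^p$, where $h$ and $g$ are analytic functions on $\mathbb{D}$. If $\operatorname{Re}(g(0)h(0))\ge 0$, then $$\left(\int_{\mathbb{D}}(|h|^2+|g|^2)^{p/2}\,dA_\alpha\right)^{1/p}\le\frac{1}{(1-|\cos(\pi/p)|)^{1/2}}\left(\int_{\mathbb{D}}|h+\overline{g}|^p\,dA_\alpha\right)^{1/p}.$$
   Context: $\mathbb{D}=\{z\in\mathbb{C}:|z|<1\}$. $dA(z)=\frac{1}{\pi}\,dx\,dy$ is normalized area measure on $\mathbb{D}$, and for $\alpha>-1$, $dA_\alpha(z)=(\alpha+1)(1-|z|^2)^\alpha\,dA(z)$. The weighted harmonic Bergman space $a_\alpha^p$ is the set of complex-valued harmonic functions $f$ on $\mathbb{D}$ with $\int_{\mathbb{D}}|f|^p\,dA_\alpha<\infty$. *)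

theory Defs
  imports "HOL-Complex_Analysis.Complex_Analysis"
begin

abbreviation unit_disc :: "complex set" where
  "unit_disc \<equiv> ball 0 1"

text \<open>Normalized area measure. The underlying space is the disc itself, so that measurability
  and integrability of a function do not depend on its values outside the disc.\<close>

definition disc_area :: "complex measure" where
  "disc_area = scale_measure (ennreal (1 / pi)) (restrict_space lborel unit_disc)"

definition weighted_area :: "real \<Rightarrow> complex measure" where
  "weighted_area \<alpha> =
     density disc_area (\<lambda>z. ennreal ((\<alpha> + 1) * (1 - (cmod z)\<^sup>2) powr \<alpha>))"

text \<open>A complex-valued function is harmonic on an open set if it is twice continuously
  differentiable in the real sense and its Laplacian vanishes. Here \<open>fx\<close>, \<open>fy\<close>, \<open>fxx\<close>, \<dots> are the
  partial derivatives with respect to \<open>x = Re z\<close> and \<open>y = Im z\<close>.\<close>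

definition harmonic_on :: "(complex \<Rightarrow> complex) \<Rightarrow> complex set \<Rightarrow> bool" where
  "harmonic_on f S \<longleftrightarrow> open S \<and>
     (\<exists>fx fy fxx fxy fyx fyy.
        (\<forall>z\<in>S. (f has_derivative (\<lambda>w. Re w *\<^sub>R fx z + Im w *\<^sub>R fy z)) (at z)) \<and>
        (\<forall>z\<in>S. (fx has_derivative (\<lambda>w. Re w *\<^sub>R fxx z + Im w *\<^sub>R fxy z)) (at z)) \<and>
        (\<forall>z\<in>S. (fy has_derivative (\<lambda>w. Re w *\<^sub>R fyx z + Im w *\<^sub>R fyy z)) (at z)) \<and>
        continuous_on S fxx \<and> continuous_on S fxy \<and>
        continuous_on S fyx \<and> continuous_on S fyy \<and>
        (\<forall>z\<in>S. fxx z + fyy z = 0))"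

definition harmonic_bergman :: "real \<Rightarrow> real \<Rightarrow> (complex \<Rightarrow> complex) set" where
  "harmonic_bergman \<alpha> p =
     {f. harmonic_on f unit_disc \<and> integrable (weighted_area \<alpha>) (\<lambda>z. cmod (f z) powr p)}"

end

theory Submission
  imports Defs
begin

text \<open>Put \<open>s = p / 2\<close> and \<open>C = 1 - |cos (pi / p)|\<close>. There is a continuous \<open>v\<close> on the plane, homogeneous of
  degree \<open>s\<close> and subharmonic, which is nonnegative on the right half plane and satisfies
  \<open>(|z|\<^sup>2 + |w|\<^sup>2) powr s + v (z w) \<le> |z + cnj w| powr p / C powr s\<close>. Up to a positive factor,
  \<open>v u\<close> is \<open>|u| powr s * cos (s |Arg u|)\<close> for \<open>p < 2\<close> and
  \<open>- |u| powr s * cos (min (s |Arg (- u)|) pi)\<close> for \<open>p \<ge> 2\<close>. Since \<open>v \<circ> (h g)\<close> is subharmonic with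
  a nonnegative value at \<open>0\<close>, its integral over every disc around \<open>0\<close> against a radial weight is
  nonnegative and can be dropped. Integrating the pointwise inequality over discs of radius \<open>r < 1\<close>,
  where everything is bounded, and letting \<open>r\<close> tend to \<open>1\<close> gives the claim.

  The sub-mean value property is obtained without a Poisson kernel: the boundary values of
  \<open>v \<circ> (h g)\<close> are approximated by real parts of polynomials (Stone-Weierstrass) and compared with
  \<open>v \<circ> (h g)\<close> by a maximum principle. Polar coordinates are replaced by averaging over rotations.\<close>

subsection \<open>Sub-mean value property\<close>

text \<open>A local form of subharmonicity. Nothing is required at \<open>0\<close>.\<close>

definition supported_below :: "(complex \<Rightarrow> real) \<Rightarrow> bool" where
  "supported_below v \<longleftrightarrow> (\<forall>u. u \<noteq> 0 \<longrightarrow>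
     (\<exists>F. F analytic_on {u} \<and> Re (F u) = v u \<and> (\<forall>\<^sub>F w in nhds u. Re (F w) \<le> v w)))"

text \<open>On the unit circle \<open>cnj z\<close> is \<open>1 / z\<close>. The product of the real
  parts of two monomials \<open>a\<close> and \<open>b\<close> is half of
  \<open>Re (a * b) + Re (a * cnj b)\<close>, so it is again the real part of a polynomial there.
  Thus polynomial boundary data get an explicit harmonic extension to the disc.\<close>

lemma real_polynomial_eq_Re_poly_on_circle:
  assumes "real_polynomial_function (q :: complex \<Rightarrow> real)"
  shows "\<exists>P. \<forall>z\<in>sphere 0 1. q z = Re (poly P z)"
  using assms
proof induction
  case (linear f)
  then interpret bounded_linear f .
  have "f z = Re (poly [:0, Complex (f 1) (- f \<i>):] z)" for z
  proof -
    have "f z = f (Re z *\<^sub>R 1 + Im z *\<^sub>R \<i>)"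
      by (metis complex_eq mult.commute scaleR_conv_of_real mult.right_neutral)
    also have "\<dots> = Re z * f 1 + Im z * f \<i>"
      by (simp only: add scale real_scaleR_def)
    finally show ?thesis by (simp add: mult.commute)
  qed
  then show ?case by blast
next
  case (const c)
  have "c = Re (poly [:of_real c:] z)" for z by simp
  then show ?case by blast
next
  case (add f g)
  then obtain P Q where "\<forall>z\<in>sphere 0 1. f z = Re (poly P z)" "\<forall>z\<in>sphere 0 1. g z = Re (poly Q z)"
    by blast
  then have "\<forall>z\<in>sphere 0 1. f z + g z = Re (poly (P + Q) z)" by simp
  then show ?case by blast
next
  case (mult f g)
  then obtain P Q where PQ: "\<forall>z\<in>sphere 0 1. f z = Re (poly P z)" "\<forall>z\<in>sphere 0 1. g z = Re (poly Q z)"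
    by blast
  \<comment> \<open>On the circle \<open>a * cnj b\<close> is a constant times \<open>z\<close> to
    the power \<open>i - j\<close>. For \<open>i < j\<close> its conjugate is used instead, which
    has the same real part and a nonnegative exponent.\<close>
  define R :: "nat \<Rightarrow> nat \<Rightarrow> complex poly" where
    "R i j = smult (1/2) (monom (coeff P i * coeff Q j) (i + j) +
       (if j \<le> i then monom (coeff P i * cnj (coeff Q j)) (i - j)
        else monom (cnj (coeff P i) * coeff Q j) (j - i)))" for i j
  have R: "Re (poly (R i j) z) = Re (coeff P i * z ^ i) * Re (coeff Q j * z ^ j)"
    if z: "z \<in> sphere 0 1" for i j z
  proof -
    define a b where "a = coeff P i * z ^ i" and "b = coeff Q j * z ^ j"
    have zz: "z * cnj z = 1" using z by (simp add: complex_norm_square[symmetric])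
    have zk: "z ^ k * cnj z ^ k = 1" for k by (metis zz power_mult_distrib power_one)
    have *: "Re (poly (if j \<le> i then monom (coeff P i * cnj (coeff Q j)) (i - j)
        else monom (cnj (coeff P i) * coeff Q j) (j - i)) z) = Re (a * cnj b)"
    proof (cases "j \<le> i")
      case True
      then have "z ^ i = z ^ (i - j) * z ^ j" by (simp flip: power_add)
      then have "a * cnj b = coeff P i * cnj (coeff Q j) * z ^ (i - j) * (z ^ j * cnj z ^ j)"
        by (simp add: a_def b_def)
      with True zk show ?thesis by (simp add: poly_monom)
    next
      case False
      then have "z ^ j = z ^ (j - i) * z ^ i" by (simp flip: power_add)
      then have "cnj a * b = cnj (coeff P i) * coeff Q j * z ^ (j - i) * (z ^ i * cnj z ^ i)"
        by (simp add: a_def b_def)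
      with zk have "cnj a * b = cnj (coeff P i) * coeff Q j * z ^ (j - i)" by simp
      moreover have "Re (a * cnj b) = Re (cnj a * b)" by simp
      ultimately show ?thesis using False by (simp add: poly_monom)
    qed
    have "poly (monom (coeff P i * coeff Q j) (i + j)) z = a * b"
      by (simp add: poly_monom a_def b_def power_add)
    then have "Re (poly (R i j) z) = 1/2 * (Re (a * b) + Re (a * cnj b))"
      unfolding R_def poly_smult poly_add by (simp only: * plus_complex.sel) (simp add: *)
    then show ?thesis by (simp add: a_def[symmetric] b_def[symmetric])
  qed
  have "\<forall>z\<in>sphere 0 1. f z * g z = Re (poly (\<Sum>i\<le>degree P. \<Sum>j\<le>degree Q. R i j) z)"
  proof
    fix z :: complex assume z: "z \<in> sphere 0 1"
    have "f z * g z = Re (\<Sum>i\<le>degree P. coeff P i * z ^ i) * Re (\<Sum>j\<le>degree Q. coeff Q j * z ^ j)"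
      using PQ z by (simp only: poly_altdef)
    also have "\<dots> = (\<Sum>i\<le>degree P. \<Sum>j\<le>degree Q. Re (coeff P i * z ^ i) * Re (coeff Q j * z ^ j))"
      by (simp only: Re_sum sum_product)
    also have "\<dots> = Re (poly (\<Sum>i\<le>degree P. \<Sum>j\<le>degree Q. R i j) z)"
      by (simp only: R[OF z] poly_sum Re_sum)
    finally show "f z * g z = Re (poly (\<Sum>i\<le>degree P. \<Sum>j\<le>degree Q. R i j) z)" .
  qed
  then show ?case by blast
qed

text \<open>The mean value property at the centre: for \<open>k > 0\<close> the power
  \<open>cis t ^ k\<close> has a periodic primitive, so only the constant coefficient survives
  integration.\<close>

lemma has_integral_Re_poly_circle:
  "((\<lambda>t. Re (poly P (cis t))) has_integral 2 * pi * Re (poly P 0)) {0..2 * pi}"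
proof -
  have *: "((\<lambda>t. cis t ^ k) has_integral (if k = 0 then of_real (2 * pi) else 0)) {0..2 * pi}" for k :: nat
  proof (cases "k = 0")
    case True
    then show ?thesis using has_integral_const_real[of "1::complex" 0 "2*pi"] by (simp add: scaleR_conv_of_real)
  next
    case False
    have "((\<lambda>t. exp (t *\<^sub>R (\<i> * k)) * (\<i> * k)) has_integral
        (exp ((2 * pi) *\<^sub>R (\<i> * k)) - exp (0 *\<^sub>R (\<i> * k)))) {0..2 * pi}"
      by (intro fundamental_theorem_of_calculus exp_scaleR_has_vector_derivative_right) auto
    moreover have "exp (t *\<^sub>R (\<i> * k)) = cis (real k * t)" for t
      by (simp add: cis_conv_exp scaleR_conv_of_real algebra_simps)
    ultimately have "((\<lambda>t. cis (real k * t) * (\<i> * k) / (\<i> * k)) has_integral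
        (cis (real k * (2 * pi)) - cis (real k * 0)) / (\<i> * k)) {0..2 * pi}"
      by (intro has_integral_divide) simp
    moreover have "cis (real k * (2*pi)) = 1"
      by (metis cis_multiple_2pi Ints_of_nat mult.commute)
    ultimately show ?thesis using False by (simp add: Complex.DeMoivre)
  qed
  have "((\<lambda>t. \<Sum>i\<le>degree P. coeff P i * cis t ^ i) has_integral
      (\<Sum>i\<le>degree P. coeff P i * (if i = 0 then of_real (2 * pi) else 0))) {0..2 * pi}"
    by (intro has_integral_sum has_integral_mult_right *) auto
  also have "(\<Sum>i\<le>degree P. coeff P i * (if i = 0 then of_real (2 * pi) else 0)) = of_real (2 * pi) * poly P 0"
    by (simp add: poly_0_coeff_0 if_distrib cong: if_cong)
  finally have "((\<lambda>t. poly P (cis t)) has_integral of_real (2 * pi) * poly P 0) {0..2 * pi}"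
    by (simp add: poly_altdef)
  from has_integral_Re[OF this] show ?thesis by simp
qed

section \<open>Maximum principle for functions with harmonic supports\<close>

text \<open>This is the maximum modulus principle for \<open>exp \<circ> \<Phi>\<close>.\<close>

lemma no_strict_local_max_Re:
  assumes "\<Phi> analytic_on {a}" "\<eta> > 0"
    and le: "\<forall>\<^sub>F z in nhds a. Re (\<Phi> z) + \<eta> * (cmod (z - a))\<^sup>2 \<le> Re (\<Phi> a)"
  shows False
proof -
  obtain e1 where e1: "e1 > 0" "\<Phi> holomorphic_on ball a e1"
    using assms(1) by (auto simp: analytic_on_def)
  obtain e2 where e2: "e2 > 0" "\<And>z. dist z a < e2 \<Longrightarrow> Re (\<Phi> z) + \<eta> * (cmod (z - a))\<^sup>2 \<le> Re (\<Phi> a)"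
    using le by (auto simp: eventually_nhds_metric)
  define r where "r = min e1 e2 / 2"
  have r: "r > 0" "r < e1" "r < e2" using e1 e2 by (auto simp: r_def)
  have hol: "(\<lambda>z. exp (\<Phi> z)) holomorphic_on ball a e1"
    using e1 by (intro holomorphic_intros)
  have sub: "cball a r \<subseteq> ball a e1" using r by auto
  \<comment> \<open>On the circle of radius \<open>r\<close> around \<open>a\<close> the hypothesis
    makes \<open>exp (\<Phi> z)\<close> smaller than at the centre by the factor
    \<open>exp (- \<eta> * r\<^sup>2)\<close>. The maximum modulus principle carries this bound to
    the centre itself.\<close>
  have "norm (exp (\<Phi> a)) \<le> exp (Re (\<Phi> a) - \<eta> * r\<^sup>2)"
  proof (rule maximum_modulus_frontier[where S = "cball a r" and f = "\<lambda>z. exp (\<Phi> z)"])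
    show "(\<lambda>z. exp (\<Phi> z)) holomorphic_on interior (cball a r)"
      using holomorphic_on_subset[OF hol] sub by (simp add: interior_cball) (meson ball_subset_cball order_trans)
    show "continuous_on (closure (cball a r)) (\<lambda>z. exp (\<Phi> z))"
      using holomorphic_on_imp_continuous_on[OF holomorphic_on_subset[OF hol sub]] by simp
    show "norm (exp (\<Phi> z)) \<le> exp (Re (\<Phi> a) - \<eta> * r\<^sup>2)" if "z \<in> frontier (cball a r)" for z
    proof -
      have "dist z a = r" using that r by (simp add: dist_commute)
      then show ?thesis using e2(2)[of z] r by (simp add: dist_norm)
    qed
  qed (use r in auto)
  then have "\<eta> * r\<^sup>2 \<le> 0" by simp
  then show False using r assms(2) by (simp add: mult_le_0_iff)
qed


text \<open>If the conclusion failed, then \<open>v (G z) - Re (P z) + \<eta> |z|\<^sup>2 + \<delta> ln |G z|\<close> would have an interior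
  maximum for small \<open>\<delta>\<close> and \<open>\<eta>\<close>. The logarithm keeps the maximum away from the zeros of \<open>G\<close>, where
  \<open>v\<close> is not known to be supported, and \<open>\<eta>\<close> makes the maximum strict after replacing \<open>v\<close> by its
  support.\<close>

lemma supported_max_principle:
  assumes v: "continuous_on UNIV v" "supported_below v"
    and G: "G holomorphic_on ball 0 1" "continuous_on (cball 0 1) G"
    and P: "P holomorphic_on ball 0 1" "continuous_on (cball 0 1) P"
    and bd: "\<And>z. z \<in> sphere 0 1 \<Longrightarrow> v (G z) \<le> Re (P z)"
    and z1: "z1 \<in> ball 0 1" "G z1 \<noteq> 0"
  shows "v (G z1) \<le> Re (P z1)"
proof (rule ccontr)
  assume neg: "\<not> v (G z1) \<le> Re (P z1)"
  define d where "d = (v (G z1) - Re (P z1)) / 2"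
  have d: "d > 0" using neg by (simp add: d_def)
  have contv: "continuous_on (cball 0 1) (\<lambda>z. v (G z) - Re (P z))"
    by (intro continuous_intros P continuous_on_compose2[OF v(1) G(2)]) auto
  have "bounded ((\<lambda>z. v (G z) - Re (P z)) ` cball 0 1)" "bounded (G ` cball 0 1)"
    by (intro compact_imp_bounded compact_continuous_image contv G compact_cball)+
  then obtain B M where B: "\<And>z. z \<in> cball 0 1 \<Longrightarrow> \<bar>v (G z) - Re (P z)\<bar> \<le> B" "B > 0"
    and M: "\<And>z. z \<in> cball 0 1 \<Longrightarrow> cmod (G z) \<le> M" "M > 0"
    unfolding bounded_pos by (force simp: real_norm_def)
  \<comment> \<open>So small that the logarithmic term lowers \<open>w\<close> at \<open>z1\<close>
    by less than \<open>d\<close>, half of the supposed excess \<open>2 * d\<close>. Hence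
    \<open>w z1 > d\<close>.\<close>
  define \<delta> where "\<delta> = d / (1 + \<bar>ln (cmod (G z1) / M)\<bar>)"
  have \<delta>: "\<delta> > 0" and \<delta>_le: "- \<delta> * ln (cmod (G z1) / M) < d"
  proof -
    show "\<delta> > 0" using d by (simp add: \<delta>_def add_pos_nonneg)
    have "d * - ln (cmod (G z1) / M) < d * (1 + \<bar>ln (cmod (G z1) / M)\<bar>)"
      using d by (intro mult_strict_left_mono) auto
    then show "- \<delta> * ln (cmod (G z1) / M) < d"
      by (simp add: \<delta>_def field_simps add_pos_nonneg)
  qed
  define \<eta> where "\<eta> = d / 2"
  \<comment> \<open>Where \<open>cmod (G z) = \<epsilon>\<close>, the logarithm outweighs the bound
    \<open>B + \<eta>\<close> of the other terms, so \<open>w\<close> is at most 0. The minimum with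
    \<open>cmod (G z1)\<close> keeps \<open>z1\<close> in \<open>K\<close>.\<close>
  define \<epsilon> where "\<epsilon> = min (cmod (G z1)) (M * exp (- (B + \<eta>) / \<delta>))"
  have eps: "\<epsilon> > 0" "\<epsilon> \<le> cmod (G z1)" "\<delta> * ln (\<epsilon> / M) \<le> - (B + \<eta>)"
  proof -
    show "\<epsilon> > 0" using z1 M by (simp add: \<epsilon>_def)
    have "\<epsilon> / M \<le> exp (- (B + \<eta>) / \<delta>)"
      using M by (simp add: \<epsilon>_def min_def field_simps)
    then have "ln (\<epsilon> / M) \<le> ln (exp (- (B + \<eta>) / \<delta>))"
      using \<open>\<epsilon> > 0\<close> M(2) by (subst ln_le_cancel_iff) auto
    then have "ln (\<epsilon> / M) \<le> - (B + \<eta>) / \<delta>"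
      by (simp only: ln_exp)
    then show "\<delta> * ln (\<epsilon> / M) \<le> - (B + \<eta>)"
      using \<delta> by (simp add: field_simps)
  qed (simp add: \<epsilon>_def)
  define K where "K = {z \<in> cball 0 1. \<epsilon> \<le> cmod (G z)}"
  define w where "w z = v (G z) - Re (P z) + \<eta> * (cmod z)\<^sup>2 + \<delta> * ln (cmod (G z) / M)" for z
  have K: "compact K" "z1 \<in> K"
  proof -
    have "closed K"
      unfolding K_def
      by (intro continuous_on_closed_Collect_le continuous_intros G) auto
    then show "compact K"
      by (metis (no_types, lifting) K_def bounded_subset bounded_cball compact_eq_bounded_closed
          mem_Collect_eq subsetI)
    show "z1 \<in> K" using z1 eps(2) by (simp add: K_def)
  qed
  \<comment> \<open>The maximum of \<open>w\<close> over \<open>K\<close> exceeds \<open>d\<close>,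
    whereas \<open>w\<close> is at most \<open>\<eta> = d / 2\<close> on the unit circle and at most
    0 where \<open>cmod (G z) = \<epsilon>\<close>. So it is attained at an interior point
    \<open>a\<close>, and it is a local maximum in the plane.\<close>
  have "continuous_on K w"
    unfolding w_def using eps(1) M(2)
    by (intro continuous_intros continuous_on_subset[OF contv] continuous_on_subset[OF G(2)])
       (auto simp: K_def)
  then obtain a where a: "a \<in> K" "\<And>z. z \<in> K \<Longrightarrow> w z \<le> w a"
    using continuous_attains_sup[OF K(1)] K(2) by blast
  have "w z1 > d"
  proof -
    have "0 \<le> \<eta> * (cmod z1)\<^sup>2" using d by (simp add: \<eta>_def)
    then show ?thesis using \<delta>_le d unfolding w_def d_def by (simp add: field_simps)
  qed
  with a K have wa: "w a > d" by force
  have a1: "a \<in> cball 0 1" using a by (simp add: K_def)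
  have Ga: "G a \<noteq> 0" using a eps(1) by (auto simp: K_def)
  have ln_le: "\<delta> * ln (cmod (G a) / M) \<le> 0"
    using M a1 Ga \<delta> by (simp add: mult_nonneg_nonpos)
  have sq: "\<eta> * (cmod a)\<^sup>2 \<le> \<eta>"
    using a1 d by (simp add: \<eta>_def power_le_one)
  have "a \<notin> sphere 0 1"
  proof
    assume "a \<in> sphere 0 1"
    then have "w a \<le> \<eta>" using bd[of a] ln_le sq by (simp add: w_def)
    then show False using wa d by (simp add: \<eta>_def)
  qed
  then have a2: "a \<in> ball 0 1" using a1 by auto
  have "cmod (G a) \<noteq> \<epsilon>"
  proof
    assume "cmod (G a) = \<epsilon>"
    then have "w a \<le> 0" using B(1)[OF a1] sq eps(3) by (simp add: w_def)
    then show False using wa d by simp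
  qed
  then have a3: "\<epsilon> < cmod (G a)" using a by (simp add: K_def)
  have "continuous_on (ball 0 1) G"
    by (intro holomorphic_on_imp_continuous_on G)
  then have "isCont G a"
    using a2 continuous_on_eq_continuous_at[OF open_ball] by blast
  then have limG: "filterlim G (nhds (G a)) (nhds a)"
    by (simp add: isCont_def tendsto_at_iff_tendsto_nhds)
  have evG: "\<forall>\<^sub>F z in nhds a. Q (G z)" if "\<forall>\<^sub>F u in nhds (G a). Q u" for Q
    using that limG unfolding filterlim_iff by blast
  have "\<forall>\<^sub>F u in nhds (G a). u \<in> {u. \<epsilon> < cmod u}"
    using a3 by (intro eventually_nhds_in_open open_Collect_less continuous_intros) auto
  then have ev1: "\<forall>\<^sub>F z in nhds a. G z \<in> {u. \<epsilon> < cmod u}"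
    by (rule evG)
  have ev2: "\<forall>\<^sub>F z in nhds a. z \<in> ball 0 1"
    using a2 by (intro eventually_nhds_in_open) auto
  have evK: "\<forall>\<^sub>F z in nhds a. w z \<le> w a \<and> z \<in> K"
    using ev1 ev2
  proof eventually_elim
    case (elim z)
    then have "z \<in> K" by (simp add: K_def)
    then show ?case using a(2) by blast
  qed
  obtain F where F: "F analytic_on {G a}" "Re (F (G a)) = v (G a)"
    "\<forall>\<^sub>F u in nhds (G a). Re (F u) \<le> v u"
    using v(2) Ga unfolding supported_below_def by blast
  \<comment> \<open>Up to a constant, \<open>Re (\<Phi> z) + \<eta> * (cmod (z - a))\<^sup>2\<close>
    is \<open>w z\<close> with \<open>v\<close> replaced by its support \<open>F\<close>: expanding
    \<open>(cmod (z - a))\<^sup>2\<close> shows that \<open>\<eta> * (cmod z)\<^sup>2\<close>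
    differs from the quadratic term by a harmonic function. Division by \<open>G a\<close> places
    the argument of \<open>Ln\<close> near 1.\<close>
  define \<Phi> where "\<Phi> z = F (G z) - P z + of_real (2 * \<eta>) * cnj a * z + of_real \<delta> * Ln (G z / G a)" for z
  have anG: "G analytic_on {a}" "P analytic_on {a}"
    using G P a2 by (auto simp: analytic_on_holomorphic intro: exI[of _ "ball 0 1"])
  have "\<Phi> analytic_on {a}"
    unfolding \<Phi>_def
    using Ga anG F(1)
    by (intro analytic_intros analytic_on_compose[of G _ F, unfolded o_def]) auto
  moreover have "\<eta> > 0" using d by (simp add: \<eta>_def)
  moreover have "\<forall>\<^sub>F z in nhds a. Re (\<Phi> z) + \<eta> * (cmod (z - a))\<^sup>2 \<le> Re (\<Phi> a)"
    using evK evG[OF F(3)]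
  proof eventually_elim
    case (elim z)
    then have Gz: "G z \<noteq> 0" using eps(1) by (auto simp: K_def)
    have "Re (\<Phi> z) + \<eta> * (cmod (z - a))\<^sup>2 =
      Re (F (G z)) - Re (P z) + 2 * \<eta> * Re (cnj a * z) + \<delta> * (ln (cmod (G z)) - ln (cmod (G a)))
       + \<eta> * (cmod (z - a))\<^sup>2"
      using Gz Ga by (simp add: \<Phi>_def norm_divide ln_div algebra_simps)
    also have "2 * \<eta> * Re (cnj a * z) = \<eta> * ((cmod z)\<^sup>2 + (cmod a)\<^sup>2 - (cmod (z - a))\<^sup>2)"
      unfolding cmod_power2 by (simp add: power2_eq_square algebra_simps)
    finally have 1: "Re (\<Phi> z) + \<eta> * (cmod (z - a))\<^sup>2 =
      Re (F (G z)) - Re (P z) + \<eta> * ((cmod z)\<^sup>2 + (cmod a)\<^sup>2) + \<delta> * (ln (cmod (G z)) - ln (cmod (G a)))"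
      by (simp add: algebra_simps)
    have 2: "Re (\<Phi> a) = v (G a) - Re (P a) + 2 * \<eta> * (cmod a)\<^sup>2"
      using Ga F(2) unfolding cmod_power2 by (simp add: \<Phi>_def power2_eq_square algebra_simps)
    show ?case
      using elim Gz Ga M(2) unfolding 1 2 w_def
      by (simp add: ln_div algebra_simps)
  qed
  ultimately show False using no_strict_local_max_Re by blast
qed

text \<open>If \<open>Re P\<close> lies slightly above \<open>v o G\<close> on the circle, the
  maximum principle puts it above \<open>v o G\<close> inside. At 0 it equals its own circle mean,
  which exceeds the mean of \<open>v o G\<close> by arbitrarily little.\<close>

theorem supported_submean_circle:
  assumes v: "continuous_on UNIV v" "supported_below v" "v 0 = 0"
    and G: "G holomorphic_on ball 0 1" "continuous_on (cball 0 1) G"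
  shows "2 * pi * v (G 0) \<le> integral {0..2 * pi} (\<lambda>t. v (G (cis t)))"
proof (cases "\<exists>z1\<in>ball 0 1. G z1 \<noteq> 0")
  case False
  have "G z = 0" if "z \<in> cball 0 1" for z
    using continuous_constant_on_closure[of "ball 0 1" G 0 z] False G(2) that by simp
  then show ?thesis using v(3) by simp
next
  case True
  then obtain z1 where z1: "z1 \<in> ball 0 1" "G z1 \<noteq> 0" by blast
  have contvG: "continuous_on (cball 0 1) (\<lambda>z. v (G z))"
    by (intro continuous_on_compose2[OF v(1) G(2)]) auto
  have int: "(\<lambda>t. v (G (cis t))) integrable_on {0..2 * pi}"
    by (intro integrable_continuous_interval continuous_on_compose2[OF contvG] continuous_intros) auto
  have "2 * pi * v (G 0) \<le> integral {0..2 * pi} (\<lambda>t. v (G (cis t))) + \<epsilon>" if "\<epsilon> > 0" for \<epsilon>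
  proof -
    define e where "e = \<epsilon> / (4 * pi)"
    have e: "e > 0" using that by (simp add: e_def)
    obtain q where q: "real_polynomial_function q" "\<And>z. z \<in> sphere 0 1 \<Longrightarrow> \<bar>v (G z) - q z\<bar> < e"
      using Stone_Weierstrass_real_polynomial_function[of "sphere 0 1" "\<lambda>z. v (G z)" e]
        continuous_on_subset[OF contvG] e by (metis compact_sphere sphere_cball)
    obtain P0 where P0: "\<And>z. z \<in> sphere 0 1 \<Longrightarrow> q z = Re (poly P0 z)"
      using real_polynomial_eq_Re_poly_on_circle[OF q(1)] by blast
    \<comment> \<open>Raising the approximation by its error \<open>e\<close> places it above the
      boundary values, at a distance of at most \<open>2 * e\<close>.\<close>
    define P where "P = P0 + [:of_real e:]"
    have P: "v (G z) \<le> Re (poly P z)" "Re (poly P z) \<le> v (G z) + 2 * e" if "z \<in> sphere 0 1" for z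
      using q(2)[OF that] P0[OF that] by (auto simp: P_def)
    have nz: "v (G z) \<le> Re (poly P z)" if "z \<in> ball 0 1" "G z \<noteq> 0" for z
      using that
      by (intro supported_max_principle[OF v(1,2) G _ _ P(1)] holomorphic_intros continuous_intros) auto
    have "v (G 0) \<le> Re (poly P 0)"
    proof (cases "G 0 = 0")
      case False
      then show ?thesis using nz[of 0] by simp
    next
      case True
      \<comment> \<open>The maximum principle says nothing at a zero of \<open>G\<close>. Zeros of a
        nonconstant \<open>G\<close> are isolated, so the inequality holds in a punctured
        neighbourhood and passes to the limit.\<close>
      have 0: "(0::complex) \<in> ball 0 1" by simp
      obtain r where r: "0 < r" "ball 0 r \<subseteq> ball (0::complex) 1" "\<And>z. z \<in> ball 0 r - {0} \<Longrightarrow> G z \<noteq> 0"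
        by (rule isolated_zeros[OF G(1) open_ball connected_ball 0 True z1]) (rule that)
      have "\<forall>\<^sub>F z in at 0. v (G z) \<le> Re (poly P z)"
        unfolding eventually_at
        by (rule exI[of _ r]) (use r nz in \<open>force simp: dist_commute subset_iff\<close>)
      moreover have "((\<lambda>z. v (G z)) \<longlongrightarrow> v (G 0)) (at 0)"
      proof -
        have "continuous_on (ball 0 1) (\<lambda>z. v (G z))"
          using contvG by (rule continuous_on_subset) auto
        then have "isCont (\<lambda>z. v (G z)) 0"
          using continuous_on_eq_continuous_at[OF open_ball, of "0::complex" 1] centre_in_ball zero_less_one
          by blast
        then show ?thesis by (rule isContD)
      qed
      moreover have "((\<lambda>z. Re (poly P z)) \<longlongrightarrow> Re (poly P 0)) (at 0)"
        by (intro tendsto_intros)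
      ultimately show ?thesis by (intro tendsto_le[of "at 0"]) auto
    qed
    then have "2 * pi * v (G 0) \<le> 2 * pi * Re (poly P 0)" by simp
    also have "\<dots> = integral {0..2 * pi} (\<lambda>t. Re (poly P (cis t)))"
      using has_integral_Re_poly_circle by (metis integral_unique)
    also have "\<dots> \<le> integral {0..2 * pi} (\<lambda>t. v (G (cis t)) + 2 * e)"
      using has_integral_Re_poly_circle[of P]
      by (intro integral_le integrable_add int) (auto simp: P intro: has_integral_integrable)
    also have "\<dots> = integral {0..2 * pi} (\<lambda>t. v (G (cis t))) + 4 * pi * e"
      by (subst Henstock_Kurzweil_Integration.integral_add[OF int]) auto
    finally show ?thesis by (simp add: e_def)
  qed
  then show ?thesis by (rule field_le_epsilon)
qed

subsection \<open>Rotation averages\<close>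

lemma prod_Basis_real2:
  fixes f :: "real^2 \<Rightarrow> 'a :: comm_monoid_mult"
  shows "(\<Prod>b\<in>Basis. f b) = f (axis 1 1) * f (axis 2 1)"
proof -
  have B: "(Basis :: (real^2) set) = {axis 1 1, axis 2 1}"
    by (auto simp: Basis_vec_def UNIV_2)
  have n: "axis 1 1 \<noteq> (axis 2 1 :: real^2)"
    by (simp add: axis_eq_axis)
  show ?thesis unfolding B using n by simp
qed

text \<open>Orthogonal invariance is available for \<open>real ^ 'n\<close> only, so the measure is transported there.\<close>

lemma lborel_distr_complex_rotation:
  assumes c: "cmod c = 1"
  shows "distr lborel borel (\<lambda>z. c * z) = (lborel :: complex measure)"
proof -
  define e :: "complex \<Rightarrow> real^2" where "e z = vector [Re z, Im z]" for z
  define e' :: "real^2 \<Rightarrow> complex" where "e' x = Complex (x $ 1) (x $ 2)" for x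
  have e[simp]: "e z $ 1 = Re z" "e z $ 2 = Im z" for z
    by (simp_all add: e_def)
  have inv[simp]: "e' (e z) = z" "e (e' x) = x" for z x
    by (simp_all add: e'_def complex_eq_iff vec_eq_iff forall_2)
  have lin: "linear e" "linear e'"
    by (auto intro!: linearI simp: vec_eq_iff forall_2 e'_def complex_eq_iff)
  have cont: "continuous_on UNIV e" "continuous_on UNIV e'"
    using lin by (simp_all add: linear_continuous_on linear_linear)
  have image_e: "e ` S = e' -` S" for S
    by (force simp: image_iff)
  \<comment> \<open>The coordinate map takes boxes to boxes with the same side lengths, which
    determines Lebesgue measure.\<close>
  have lb: "lborel = distr lborel borel e"
  proof (rule lborel_eqI)
    fix l u :: "real^2" assume lu: "\<And>b. b \<in> Basis \<Longrightarrow> l \<bullet> b \<le> u \<bullet> b"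
    have "l $ i \<le> u $ i" for i
      using lu[of "axis i 1"] by (simp add: inner_axis)
    moreover have "e -` box l u = box (e' l) (e' u)"
      by (auto simp: box_def Basis_complex_def Basis_vec_def inner_axis forall_2 e'_def UNIV_2 algebra_simps)
    ultimately have "emeasure lborel (e -` box l u) = ennreal ((u $ 1 - l $ 1) * (u $ 2 - l $ 2))"
      by (subst \<open>e -` box l u = _\<close>, subst emeasure_lborel_box)
         (auto simp: Basis_complex_def e'_def)
    then show "emeasure (distr lborel borel e) (box l u) = ennreal (\<Prod>b\<in>Basis. (u - l) \<bullet> b)"
      using cont by (simp add: emeasure_distr prod_Basis_real2 inner_axis borel_measurable_continuous_onI)
  qed simp
  have emb: "emeasure lborel S = emeasure lborel (e ` S)" if S: "S \<in> sets borel" for S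
  proof -
    have "e ` S \<in> sets borel"
      unfolding image_e using S cont(2) by (metis borel_measurable_continuous_onI measurable_sets_borel)
    then have "emeasure lborel (e ` S) = emeasure lborel (e -` e ` S)"
      using cont(1) by (subst lb) (simp add: emeasure_distr borel_measurable_continuous_onI)
    also have "e -` e ` S = S"
      using inv(1) by (metis inj_on_def inj_vimage_image_eq)
    finally show ?thesis by simp
  qed
  \<comment> \<open>The image measure is computed from preimages, and the preimage under
    multiplication by \<open>c\<close> is the image under multiplication by
    \<open>cnj c\<close>.\<close>
  define T where "T x = e (cnj c * e' x)" for x
  have cc: "cnj c * c = 1" using c by (metis complex_norm_square mult.commute of_real_1 power_one)
  have "orthogonal_transformation T"
    unfolding orthogonal_transformation
  proof
    show "linear T"
      unfolding T_def using lin
      by (auto intro!: linearI simp: linear_add linear_scale algebra_simps)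
    have norm_e: "norm (e z) = cmod z" for z
      by (simp add: norm_vec_def L2_set_def UNIV_2 cmod_def)
    have "cmod (e' x) = norm x" for x
      using norm_e[of "e' x"] by simp
    then show "\<forall>v. norm (T v) = norm v"
      by (simp add: T_def norm_e norm_mult c)
  qed
  show ?thesis
  proof (rule lborel_eqI[symmetric])
    fix l u :: complex assume lu: "\<And>b. b \<in> Basis \<Longrightarrow> l \<bullet> b \<le> u \<bullet> b"
    have pre: "(\<lambda>z. c * z) -` box l u = (\<lambda>z. cnj c * z) ` box l u"
    proof (intro equalityI subsetI)
      fix z assume "z \<in> (\<lambda>z. c * z) -` box l u"
      moreover have "z = cnj c * (c * z)" using cc by (simp add: mult.assoc[symmetric])
      ultimately show "z \<in> (\<lambda>z. cnj c * z) ` box l u" by blast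
    next
      fix z assume "z \<in> (\<lambda>z. cnj c * z) ` box l u"
      then obtain w where "w \<in> box l u" "z = cnj c * w" by blast
      moreover from this have "c * z = (cnj c * c) * w" by simp
      ultimately have "c * z \<in> box l u" by (simp only: cc mult_1_left)
      then show "z \<in> (\<lambda>z. c * z) -` box l u" by simp
    qed
    have meas: "(\<lambda>z. c * z) \<in> borel_measurable borel" by measurable
    have op: "open (e ` box l u)"
      unfolding image_e using cont(2) by (simp add: open_vimage open_box)
    moreover have "bounded (e ` box l u)"
      using lin(1) by (intro bounded_linear_image bounded_box) (simp add: linear_conv_bounded_linear)
    ultimately have fin: "e ` box l u \<in> lmeasurable"
      by (rule lmeasurable_open[rotated])
    have "emeasure (distr lborel borel (\<lambda>z. c * z)) (box l u) = emeasure lborel ((\<lambda>z. c * z) -` box l u)"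
      by (simp add: emeasure_distr)
    also have "\<dots> = emeasure lborel (e ` ((\<lambda>z. c * z) -` box l u))"
      using meas by (intro emb) (metis borel_open measurable_sets_borel open_box)
    also have "e ` ((\<lambda>z. c * z) -` box l u) = T ` (e ` box l u)"
      unfolding pre T_def by (auto simp: image_image)
    also have "emeasure lborel (T ` (e ` box l u)) = emeasure lebesgue (T ` (e ` box l u))"
    proof -
      have "(\<lambda>z. c * z) -` box l u \<in> sets borel"
        using meas by (metis borel_open measurable_sets_borel open_box)
      then have "e ` ((\<lambda>z. c * z) -` box l u) \<in> sets borel"
        unfolding image_e using cont(2) by (metis borel_measurable_continuous_onI measurable_sets_borel)
      then show ?thesis
        unfolding pre T_def by (simp add: image_image)
    qed
    also have "\<dots> = emeasure lebesgue (e ` box l u)"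
      using measure_orthogonal_image[OF \<open>orthogonal_transformation T\<close> fin]
        measurable_orthogonal_image[OF \<open>orthogonal_transformation T\<close> fin] fin
      by (simp add: emeasure_eq_measure2 fmeasurableD2)
    also have "\<dots> = emeasure lborel (e ` box l u)"
      using op by (simp add: borel_open)
    also have "\<dots> = emeasure lborel (box l u)"
      by (rule emb[symmetric]) simp
    also have "\<dots> = ennreal (\<Prod>b\<in>Basis. (u - l) \<bullet> b)"
      using lu by (rule emeasure_lborel_box)
    finally show "emeasure (distr lborel borel (\<lambda>z. c * z)) (box l u) = ennreal (\<Prod>b\<in>Basis. (u - l) \<bullet> b)" .
  qed simp
qed

text \<open>By rotation invariance, \<open>u\<close> and each \<open>u (cis t * z)\<close> have the
  same integral over the plane. Integrating over \<open>t\<close> and exchanging the order gives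
  \<open>2 * pi\<close> times the integral of \<open>u\<close> as an integral of nonnegative circle
  means. The bound and the bounded support justify the exchange.\<close>

lemma integral_nonneg_if_circle_means_nonneg:
  fixes u :: "complex \<Rightarrow> real"
  assumes meas[measurable]: "u \<in> borel_measurable borel"
    and bound: "\<And>z. \<bar>u z\<bar> \<le> B" and supp: "\<And>z. r < cmod z \<Longrightarrow> u z = 0"
    and mean: "\<And>z. 0 \<le> (LINT t:{0..2 * pi}|lborel. u (cis t * z))"
  shows "0 \<le> (\<integral>z. u z \<partial>lborel)"
proof -
  define F where "F t z = indicator {0..2 * pi} t * u (cis t * z)" for t :: real and z
  have cis_meas[measurable]: "cis \<in> borel_measurable borel"
    by (intro borel_measurable_continuous_onI continuous_intros)
  have Fm: "case_prod F \<in> borel_measurable (lborel \<Otimes>\<^sub>M lborel)"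
    unfolding F_def by measurable
  have int_ind: "integrable (lborel \<Otimes>\<^sub>M lborel) (indicator ({0..2 * pi} \<times> cball 0 r) :: real \<times> complex \<Rightarrow> real)"
  proof (rule integrable_real_indicator)
    have "emeasure (lborel \<Otimes>\<^sub>M lborel) ({0..2 * pi} \<times> cball (0::complex) r) =
        emeasure lborel {0..2 * pi} * emeasure lborel (cball (0::complex) r)"
      by (rule lborel.emeasure_pair_measure_Times) auto
    also have "\<dots> < \<infinity>"
      using emeasure_lborel_cball_finite[of "0::complex" r] by (simp add: ennreal_mult_less_top)
    finally show "emeasure (lborel \<Otimes>\<^sub>M lborel) ({0..2 * pi} \<times> cball (0::complex) r) < \<infinity>" .
  qed (auto intro!: pair_measureI)
  have *: "(\<integral>z. F t z \<partial>lborel) = indicator {0..2 * pi} t * (\<integral>z. u z \<partial>lborel)" for t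
  proof -
    have "(\<integral>z. u z \<partial>lborel) = (\<integral>z. u z \<partial>distr lborel borel (\<lambda>z. cis t * z))"
      by (subst lborel_distr_complex_rotation) auto
    also have "\<dots> = (\<integral>z. u (cis t * z) \<partial>lborel)"
      by (rule integral_distr) auto
    finally show ?thesis by (simp add: F_def)
  qed
  have "integrable (lborel \<Otimes>\<^sub>M lborel) (case_prod F)"
  proof (rule Bochner_Integration.integrable_bound[OF integrable_mult_right[OF int_ind, of B] Fm])
    have "\<bar>F t z\<bar> \<le> B * indicator ({0..2 * pi} \<times> cball 0 r) (t, z)" for t z
      using bound[of "cis t * z"] supp[of "cis t * z"]
      by (auto simp: F_def indicator_def norm_mult)
    then show "AE x in lborel \<Otimes>\<^sub>M lborel. norm (case_prod F x)
        \<le> norm (B * indicator ({0..2 * pi} \<times> cball 0 r) x)"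
      by (intro AE_I2) (force simp: order_trans[OF _ abs_ge_self])
  qed
  then have "(\<integral>z. \<integral>t. F t z \<partial>lborel \<partial>lborel) = (\<integral>t. \<integral>z. F t z \<partial>lborel \<partial>lborel)"
    by (rule lborel_pair.Fubini_integral)
  also have "\<dots> = 2 * pi * (\<integral>z. u z \<partial>lborel)"
    by (simp add: *)
  finally have "(\<integral>z. \<integral>t. F t z \<partial>lborel \<partial>lborel) = 2 * pi * (\<integral>z. u z \<partial>lborel)" .
  moreover have "0 \<le> (\<integral>z. \<integral>t. F t z \<partial>lborel \<partial>lborel)"
  proof (rule Bochner_Integration.integral_nonneg)
    show "0 \<le> (\<integral>t. F t z \<partial>lborel)" for z
      using mean[of z] by (simp add: F_def set_lebesgue_integral_def)
  qed
  ultimately show ?thesis using pi_gt_zero by (auto simp: zero_le_mult_iff)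
qed

subsection \<open>The pointwise inequality\<close>

lemma unimodal_min:
  fixes f f' :: "real \<Rightarrow> real"
  assumes cont: "continuous_on {a..b} f"
    and der: "\<And>x. a < x \<Longrightarrow> x < b \<Longrightarrow> (f has_real_derivative f' x) (at x)"
    and neg: "\<And>x. a < x \<Longrightarrow> x < c \<Longrightarrow> f' x \<le> 0"
    and pos: "\<And>x. c < x \<Longrightarrow> x < b \<Longrightarrow> f' x \<ge> 0"
    and c: "a \<le> c" "c \<le> b" and x: "x \<in> {a..b}"
  shows "f c \<le> f x"
proof (cases "x \<le> c")
  case True
  then show ?thesis
    using x c neg der
    by (intro DERIV_nonpos_imp_decreasing_open[of x c f] continuous_on_subset[OF cont]) force+
next
  case False
  then show ?thesis
    using x c pos der
    by (intro DERIV_nonneg_imp_increasing_open[of c x f] continuous_on_subset[OF cont]) force+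
qed

text \<open>The difference of the two sides vanishes at 0 and has derivative
  \<open>p * (2 - p) * sin y * sin ((p - 1) * y)\<close>, which is nonnegative here. It is the
  numerator that decides the monotonicity of \<open>Q\<close> in \<open>cos_powr_ge\<close>.\<close>

lemma sin_mult_ge:
  assumes p: "1 < p" "p < 2" and x: "0 \<le> x" "x \<le> pi / 2"
  shows "sin (p * x) \<le> p * sin x * cos ((p - 1) * x)"
proof -
  define N where "N x = p * sin x * cos ((p - 1) * x) - sin (p * x)" for x
  have "N 0 \<le> N x"
  proof (rule DERIV_nonneg_imp_nondecreasing[OF x(1)])
    fix y assume y: "0 \<le> y" "y \<le> x"
    have "(p - 1) * y \<le> 1 * pi"
      using p y x by (intro mult_mono) auto
    then have nn: "0 \<le> sin ((p - 1) * y)" "0 \<le> sin y"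
      using p y x by (intro sin_ge_zero; simp)+
    have "cos (p * y) = cos ((p - 1) * y) * cos y - sin ((p - 1) * y) * sin y"
      by (simp flip: cos_add add: algebra_simps)
    then have "p * cos (p * y) = p * (cos ((p - 1) * y) * cos y) - p * (sin ((p - 1) * y) * sin y)"
      by (simp only: right_diff_distrib)
    then have "(N has_real_derivative p * (2 - p) * sin y * sin ((p - 1) * y)) (at y)"
      unfolding N_def by (auto intro!: derivative_eq_intros simp: algebra_simps)
    moreover have "0 \<le> p * (2 - p) * sin y * sin ((p - 1) * y)"
      using p nn by simp
    ultimately show "\<exists>d. (N has_real_derivative d) (at y) \<and> 0 \<le> d" by blast
  qed
  then show ?thesis by (simp add: N_def)
qed

text \<open>The counterpart of \<open>sin_mult_ge\<close> for \<open>sin_powr_ge\<close>. The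
  derivative has a sign only while \<open>(p - 1) * x\<close> is at most \<open>pi / 2\<close>.
  Beyond that, \<open>cos ((p - 1) * x)\<close> is nonpositive and the addition formula for
  \<open>sin (x + (p - 1) * x)\<close> suffices.\<close>

lemma sin_le_cos_mult:
  assumes p: "2 \<le> p" and x: "0 \<le> x" "x \<le> pi / p"
  shows "sin (p * x) \<le> p * cos x * sin ((p - 1) * x)"
proof (cases "(p - 1) * x \<le> pi / 2")
  case True
  define N where "N x = sin (p * x) - p * cos x * sin ((p - 1) * x)" for x
  have "x \<le> pi / 2" using p x by (smt (verit) divide_left_mono pi_gt_zero mult_pos_pos)
  have "N 0 \<ge> N x"
  proof (rule DERIV_nonpos_imp_nonincreasing[OF x(1)])
    fix y assume y: "0 \<le> y" "y \<le> x"
    have "(p - 1) * y \<le> (p - 1) * x" "0 \<le> (p - 1) * y"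
      using p y by (simp_all add: mult_left_mono)
    then have nn: "0 \<le> cos ((p - 1) * y)" "0 \<le> cos y"
      using p y x True \<open>x \<le> pi / 2\<close> by (intro cos_ge_zero; linarith)+
    have "cos (p * y) = cos ((p - 1) * y) * cos y - sin ((p - 1) * y) * sin y"
      by (simp flip: cos_add add: algebra_simps)
    then have "p * cos (p * y) = p * (cos ((p - 1) * y) * cos y) - p * (sin ((p - 1) * y) * sin y)"
      by (simp only: right_diff_distrib)
    then have "(N has_real_derivative - (p * (p - 2) * cos y * cos ((p - 1) * y))) (at y)"
      unfolding N_def by (auto intro!: derivative_eq_intros simp: algebra_simps)
    moreover have "0 \<le> p * (p - 2) * cos y * cos ((p - 1) * y)"
      using p nn by simp
    ultimately show "\<exists>d. (N has_real_derivative d) (at y) \<and> d \<le> 0" by force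
  qed
  then show ?thesis by (simp add: N_def)
next
  case False
  have "x \<le> pi / 2" using p x by (smt (verit) divide_left_mono pi_gt_zero mult_pos_pos)
  have "(p - 1) * x \<le> pi" using p x by (simp add: field_simps)
  have "sin (p * x) = sin x * cos ((p - 1) * x) + cos x * sin ((p - 1) * x)"
    using sin_add[of x "(p - 1) * x"] by (simp add: left_diff_distrib)
  moreover have "sin x * cos ((p - 1) * x) \<le> 0"
  proof -
    have "cos ((p - 1) * x) \<le> cos (pi / 2)"
      using False \<open>(p - 1) * x \<le> pi\<close> by (intro cos_monotone_0_pi_le) auto
    moreover have "0 \<le> sin x" using x \<open>x \<le> pi / 2\<close> by (intro sin_ge_zero) auto
    ultimately show ?thesis by (simp add: mult_nonneg_nonpos)
  qed
  moreover have "0 \<le> (p - 1) * (cos x * sin ((p - 1) * x))"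
    using p x \<open>x \<le> pi / 2\<close> \<open>(p - 1) * x \<le> pi\<close>
    by (intro mult_nonneg_nonneg cos_ge_zero sin_ge_zero) auto
  ultimately show ?thesis by (simp add: algebra_simps)
qed

text \<open>The sign of the derivative is decided by the monotonicity of
  \<open>sin (p x) / (cos x powr (p - 1) * sin x)\<close>, which equals \<open>1 / (cos x powr (p - 1) * sin x)\<close>
  at the critical point \<open>x = pi / (2 p)\<close>.\<close>

lemma cos_powr_ge:
  assumes p: "1 < p" "p < 2" and x: "0 \<le> x" "x \<le> pi / 2"
  defines "x0 \<equiv> pi / (2 * p)"
  shows "1 + tan x0 * cos (p * x) \<le> (cos x / cos x0) powr p"
proof -
  have x0: "0 < x0" "x0 < pi / 2" using p by (auto simp: x0_def field_simps)
  have px0: "p * x0 = pi / 2" using p by (simp add: x0_def)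
  have c0: "0 < cos x0" "0 < sin x0"
    using x0 by (auto intro: cos_gt_zero sin_gt_zero2)
  define Q where "Q x = sin (p * x) / (cos x powr (p - 1) * sin x)" for x
  define L where "L x = (cos x / cos x0) powr p - 1 - tan x0 * cos (p * x)" for x
  define D where "D x = p * (tan x0 * sin (p * x) - cos x powr (p - 1) * sin x / cos x0 powr p)" for x
  have Qmono: "Q a \<le> Q b" if ab: "0 < a" "a \<le> b" "b < pi / 2" for a b
  proof (rule DERIV_nonneg_imp_nondecreasing[OF ab(2)])
    fix y assume "a \<le> y" "y \<le> b"
    then have y: "0 < y" "y < pi / 2" using ab by auto
    have cs: "0 < cos y" "0 < sin y"
      using y by (auto intro: cos_gt_zero sin_gt_zero2)
    have cp: "cos y powr (p - 1) = cos y powr (p - 2) * cos y"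
      using cs powr_add[of "cos y" "p - 2" 1] by simp
    define N where "N = p * sin y * cos ((p - 1) * y) - sin (p * y)"
    have "N \<ge> 0" using sin_mult_ge[OF p, of y] y by (simp add: N_def)
    have cpy: "cos ((p - 1) * y) = cos (p * y) * cos y + sin (p * y) * sin y"
      using cos_diff[of "p * y" y] by (simp add: left_diff_distrib)
    \<comment> \<open>The numerator of the quotient rule for \<open>Q\<close>. Expressing
      \<open>cos (p * y) * cos y\<close> through \<open>cos ((p - 1) * y)\<close> collapses it to a
      power of \<open>cos y\<close> times \<open>N\<close>.\<close>
    define d where "d = (p * cos (p * y) * (cos y powr (p - 1) * sin y) - sin (p * y) *
        ((p - 1) * cos y powr (p - 2) * (- sin y) * sin y + cos y powr (p - 1) * cos y))"
    have "cos y * cos y + sin y * sin y = 1"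
      by (rule sin_cos_squared_add3)
    then have *: "p * sin y * (cos ((p - 1) * y) - sin (p * y) * sin y) - sin (p * y) *
        (- (p - 1) * (sin y * sin y) + cos y * cos y) = p * sin y * cos ((p - 1) * y) - sin (p * y)"
      by algebra
    have "d = cos y powr (p - 2) * (p * sin y * (cos (p * y) * cos y) - sin (p * y) *
        (- (p - 1) * (sin y * sin y) + cos y * cos y))"
      unfolding d_def cp by algebra
    also have "cos (p * y) * cos y = cos ((p - 1) * y) - sin (p * y) * sin y"
      by (simp add: cpy)
    also have "cos y powr (p - 2) * (p * sin y * (cos ((p - 1) * y) - sin (p * y) * sin y) - sin (p * y) *
        (- (p - 1) * (sin y * sin y) + cos y * cos y)) = cos y powr (p - 2) * N"
      using * by (simp add: N_def)
    finally have dN: "d = cos y powr (p - 2) * N" .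
    have "(Q has_real_derivative d / (cos y powr (p - 1) * sin y)\<^sup>2) (at y)"
      unfolding Q_def d_def using cs
      by (auto intro!: derivative_eq_intros simp: power2_eq_square algebra_simps)
    moreover have "d / (cos y powr (p - 1) * sin y)\<^sup>2 \<ge> 0"
      using dN \<open>N \<ge> 0\<close> by simp
    ultimately show "\<exists>d. (Q has_real_derivative d) (at y) \<and> 0 \<le> d" by blast
  qed
  \<comment> \<open>The derivative of \<open>L\<close> is a nonnegative factor times
    \<open>Q y - Q x0\<close>. As \<open>Q\<close> is increasing, \<open>L\<close> falls before
    \<open>x0\<close> and rises after it, and \<open>L x0 = 0\<close>.\<close>
  have DQ: "D y = p * (cos y powr (p - 1) * sin y * tan x0) * (Q y - Q x0)" if y: "0 < y" "y < pi / 2" for y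
  proof -
    have cs: "0 < cos y" "0 < sin y"
      using y by (auto intro: cos_gt_zero sin_gt_zero2)
    have "cos x0 powr p = cos x0 powr (p - 1) * cos x0"
      using c0 powr_add[of "cos x0" "p - 1" 1] by simp
    then show ?thesis using cs c0
      by (simp add: D_def Q_def px0 tan_def field_simps)
  qed
  have der: "(L has_real_derivative D y) (at y)" if y: "0 < y" "y < pi / 2" for y
  proof -
    have cs: "0 < cos y" using y by (auto intro: cos_gt_zero)
    show ?thesis unfolding L_def D_def using cs c0
      by (auto intro!: derivative_eq_intros simp: powr_divide powr_diff field_simps)
  qed
  have tan0: "0 < tan x0" using x0 by (intro tan_gt_zero) auto
  have fac: "0 \<le> p * (cos y powr (p - 1) * sin y * tan x0)" if y: "0 < y" "y < pi / 2" for y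
    using y p tan0 sin_gt_zero2[of y] by simp
  have cospos: "cos y \<ge> 0" if "0 \<le> y" "y \<le> pi / 2" for y
    using that by (intro cos_ge_zero) auto
  have cont: "continuous_on {0..pi / 2} L"
    unfolding L_def using p c0 by (intro continuous_on_powr' continuous_intros) (auto intro!: cospos divide_nonneg_pos)
  have "L x0 \<le> L x"
  proof (rule unimodal_min[where f = L and x = x and c = x0 and a = 0 and b = "pi / 2" and f' = D])
    show "D y \<le> 0" if "0 < y" "y < x0" for y
      using Qmono[of y x0] that x0 fac[of y] by (simp add: DQ mult_nonneg_nonpos)
    show "D y \<ge> 0" if "x0 < y" "y < pi / 2" for y
      using Qmono[of x0 y] that x0 fac[of y] by (simp add: DQ)
  qed (use der cont x x0 in simp_all)
  then show ?thesis using c0 by (simp add: L_def px0)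
qed

text \<open>The argument of \<open>cos_powr_ge\<close> with sine and cosine exchanged. Now
  \<open>Q\<close> is decreasing, and the derivative of \<open>L\<close> is a nonnegative factor
  times \<open>Q x0 - Q y\<close>, so \<open>x0\<close> is again the minimum, with value 0.\<close>

lemma sin_powr_ge:
  assumes p: "2 \<le> p" and x: "0 \<le> x" "x \<le> pi / p"
  defines "x0 \<equiv> pi / (2 * p)"
  shows "1 - cot x0 * cos (p * x) \<le> (sin x / sin x0) powr p"
proof -
  have pp: "pi / p \<le> pi / 2" using p by (simp add: field_simps)
  have x0: "0 < x0" "x0 < pi / p" using p by (auto simp: x0_def field_simps)
  have px0: "p * x0 = pi / 2" using p by (simp add: x0_def)
  have "x0 < pi / 2" using x0 pp by linarith
  then have c0: "0 < cos x0" "0 < sin x0"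
    using x0 by (auto intro: cos_gt_zero sin_gt_zero2)
  define Q where "Q x = sin (p * x) / (sin x powr (p - 1) * cos x)" for x
  define L where "L x = (sin x / sin x0) powr p - 1 + cot x0 * cos (p * x)" for x
  define D where "D x = p * (sin x powr (p - 1) * cos x / sin x0 powr p - cot x0 * sin (p * x))" for x
  have Qmono: "Q a \<ge> Q b" if ab: "0 < a" "a \<le> b" "b < pi / p" for a b
  proof (rule DERIV_nonpos_imp_nonincreasing[OF ab(2)])
    fix y assume "a \<le> y" "y \<le> b"
    then have y: "0 < y" "y < pi / p" using ab by auto
    then have "y < pi / 2" using pp by linarith
    have cs: "0 < cos y" "0 < sin y"
      using y \<open>y < pi / 2\<close> by (auto intro: cos_gt_zero sin_gt_zero2)
    have cp: "sin y powr (p - 1) = sin y powr (p - 2) * sin y"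
      using cs powr_add[of "sin y" "p - 2" 1] by simp
    define N where "N = sin (p * y) - p * cos y * sin ((p - 1) * y)"
    have "N \<le> 0" using sin_le_cos_mult[OF p, of y] y by (simp add: N_def)
    have cpy: "sin ((p - 1) * y) = sin (p * y) * cos y - cos (p * y) * sin y"
      using sin_diff[of "p * y" y] by (simp add: left_diff_distrib)
    define d where "d = (p * cos (p * y) * (sin y powr (p - 1) * cos y) - sin (p * y) *
        ((p - 1) * sin y powr (p - 2) * cos y * cos y - sin y powr (p - 1) * sin y))"
    have "cos y * cos y + sin y * sin y = 1"
      by (rule sin_cos_squared_add3)
    then have *: "p * cos y * (sin (p * y) * cos y - sin ((p - 1) * y)) - sin (p * y) *
        ((p - 1) * (cos y * cos y) - sin y * sin y) = sin (p * y) - p * cos y * sin ((p - 1) * y)"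
      by algebra
    have "d = sin y powr (p - 2) * (p * cos y * (cos (p * y) * sin y) - sin (p * y) *
        ((p - 1) * (cos y * cos y) - sin y * sin y))"
      unfolding d_def cp by algebra
    also have "p * cos y * (cos (p * y) * sin y) = p * cos y * (sin (p * y) * cos y - sin ((p - 1) * y))"
      by (simp add: cpy)
    also have "sin y powr (p - 2) * (p * cos y * (sin (p * y) * cos y - sin ((p - 1) * y)) - sin (p * y) *
        ((p - 1) * (cos y * cos y) - sin y * sin y)) = sin y powr (p - 2) * N"
      using * by (simp add: N_def)
    finally have dN: "d = sin y powr (p - 2) * N" .
    have "(Q has_real_derivative d / (sin y powr (p - 1) * cos y)\<^sup>2) (at y)"
      unfolding Q_def d_def using cs
      by (auto intro!: derivative_eq_intros simp: power2_eq_square algebra_simps)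
    moreover have "d / (sin y powr (p - 1) * cos y)\<^sup>2 \<le> 0"
      using dN \<open>N \<le> 0\<close> by (simp add: divide_nonpos_nonneg mult_nonneg_nonpos)
    ultimately show "\<exists>d. (Q has_real_derivative d) (at y) \<and> d \<le> 0" by blast
  qed
  have y2: "y < pi / 2" if "y < pi / p" for y
    using that pp by linarith
  have DQ: "D y = p * (sin y powr (p - 1) * cos y * cot x0) * (Q x0 - Q y)" if y: "0 < y" "y < pi / p" for y
  proof -
    have cs: "0 < cos y" "0 < sin y"
      using y y2[OF y(2)] by (auto intro: cos_gt_zero sin_gt_zero2)
    have "sin x0 powr p = sin x0 powr (p - 1) * sin x0"
      using c0 powr_add[of "sin x0" "p - 1" 1] by simp
    then show ?thesis using cs c0
      by (simp add: D_def Q_def px0 cot_def field_simps)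
  qed
  have der: "(L has_real_derivative D y) (at y)" if y: "0 < y" "y < pi / p" for y
  proof -
    have cs: "0 < sin y" using y y2[OF y(2)] by (auto intro: sin_gt_zero2)
    show ?thesis unfolding L_def D_def using cs c0
      by (auto intro!: derivative_eq_intros simp: powr_divide powr_diff field_simps)
  qed
  have cot0: "0 < cot x0" using c0 by (simp add: cot_def)
  have fac: "0 \<le> p * (sin y powr (p - 1) * cos y * cot x0)" if y: "0 < y" "y < pi / p" for y
    using y p y2[OF y(2)] cot0 cos_gt_zero[of y] by simp
  have sinpos: "sin y \<ge> 0" if "0 \<le> y" "y \<le> pi / p" for y
    using that pp pi_gt_zero by (intro sin_ge_zero) linarith+
  have cont: "continuous_on {0..pi / p} L"
    unfolding L_def using p c0 by (intro continuous_on_powr' continuous_intros) (auto intro!: sinpos divide_nonneg_pos)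
  have "L x0 \<le> L x"
  proof (rule unimodal_min[where f = L and x = x and c = x0 and a = 0 and b = "pi / p" and f' = D])
    show "D y \<le> 0" if "0 < y" "y < x0" for y
      using Qmono[of y x0] that x0 fac[of y] by (simp add: DQ mult_nonneg_nonpos)
    show "D y \<ge> 0" if "x0 < y" "y < pi / p" for y
      using Qmono[of x0 y] that x0 fac[of y] by (simp add: DQ)
  qed (use der cont x x0 in simp_all)
  then show ?thesis using c0 by (simp add: L_def px0)
qed

section \<open>From one variable to the modulus, the real part and the mean square\<close>

text \<open>\<open>r powr s * cos (s * arccos (x / r))\<close> is the value of the harmonic function \<open>Re (u powr s)\<close> at
  the point \<open>u\<close> with \<open>Re u = x\<close> and \<open>cmod u = r\<close>.\<close>

lemma powr_cos_arccos_deriv: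
  assumes "\<bar>x\<bar> < r"
  shows "((\<lambda>r. r powr s * cos (s * arccos (x / r))) has_real_derivative
     s * r powr (s - 1) * (sin ((1 - s) * arccos (x / r)) / sin (arccos (x / r)))) (at r)"
proof -
  have r: "0 < r" using assms by simp
  define a where "a = arccos (x / r)"
  have xr: "- 1 < x / r" "x / r < 1" using assms r by (auto simp: field_simps)
  then have ca: "cos a = x / r" by (simp add: a_def)
  have sa: "sin a = sqrt (1 - (x / r)\<^sup>2)" using xr by (simp add: a_def sin_arccos)
  have sa0: "0 < sin a"
    unfolding a_def using arccos_lt_bounded[OF xr] by (intro sin_gt_zero) auto
  have da: "((\<lambda>r. arccos (x / r)) has_real_derivative (cos a / (r * sin a))) (at r)"
  proof -
    have "(arccos has_real_derivative inverse (- sin a)) (at (x / r))"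
      using DERIV_arccos[OF xr] by (simp add: sa)
    moreover have "((\<lambda>r. x / r) has_real_derivative - (x / (r * r))) (at r)"
      using r by (auto intro!: derivative_eq_intros simp: divide_inverse)
    ultimately have "((\<lambda>r. arccos (x / r)) has_real_derivative inverse (- sin a) * - (x / (r * r))) (at r)"
      by (rule DERIV_chain2)
    also have "inverse (- sin a) * - (x / (r * r)) = cos a / (r * sin a)"
      using r sa0 by (simp add: ca field_simps)
    finally show ?thesis .
  qed
  have rs: "r powr s = r powr (s - 1) * r"
    using r powr_add[of r "s - 1" 1] by simp
  have sn: "sin ((1 - s) * a) = sin a * cos (s * a) - cos a * sin (s * a)"
    using sin_diff[of a "s * a"] by (simp add: left_diff_distrib)
  have "((\<lambda>r. cos (s * arccos (x / r))) has_real_derivative - sin (s * a) * (s * (cos a / (r * sin a)))) (at r)"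
    using DERIV_chain2[OF DERIV_cos DERIV_cmult[OF da, of s]] by (simp add: a_def)
  from DERIV_mult[OF has_real_derivative_powr[OF r, of s] this]
  have "((\<lambda>r. r powr s * cos (s * arccos (x / r))) has_real_derivative
     s * r powr (s - 1) * cos (s * a) + r powr s * (- sin (s * a) * (s * (cos a / (r * sin a))))) (at r)"
    by (simp add: a_def algebra_simps)
  also have "s * r powr (s - 1) * cos (s * a) + r powr s * (- sin (s * a) * (s * (cos a / (r * sin a))))
      = s * r powr (s - 1) * (sin ((1 - s) * a) / sin a)"
    unfolding rs sn using r sa0 by (simp add: field_simps)
  finally show ?thesis by (simp add: a_def)
qed

lemma continuous_on_powr_cos_arccos:
  assumes "s > 0" "r > 0" "\<bar>x\<bar> \<le> r"
  shows "continuous_on {r..\<rho>} (\<lambda>r. r powr s * cos (s * arccos (x / r)))"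
proof -
  have "- 1 \<le> x / t \<and> x / t \<le> 1" if "t \<in> {r..\<rho>}" for t
    using assms that by (auto simp: field_simps)
  then show ?thesis
    using assms by (intro continuous_intros continuous_on_powr' continuous_on_arccos) auto
qed

lemma one_minus_abs_cos_pi_div:
  assumes "1 < p"
  shows "0 < 1 - \<bar>cos (pi / p)\<bar>" "1 - \<bar>cos (pi / p)\<bar> \<le> 1"
proof -
  have "0 < pi / p" "pi / p < pi" using assms by (auto simp: field_simps)
  then have "0 < sin (pi / p)" by (intro sin_gt_zero)
  then have "\<bar>cos (pi / p)\<bar> \<noteq> 1"
    using sin_cos_squared_add[of "pi / p"] by (auto simp: power2_eq_square abs_if split: if_splits)
  then show "0 < 1 - \<bar>cos (pi / p)\<bar>" using abs_cos_le_one[of "pi / p"] by linarith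
qed simp

lemma powr_quotient_sq: "0 \<le> a \<Longrightarrow> 0 \<le> b \<Longrightarrow> (a\<^sup>2 / b\<^sup>2) powr (p / 2) = (a / b) powr (p::real)"
proof -
  assume ab: "0 \<le> a" "0 \<le> b"
  have "(a\<^sup>2 / b\<^sup>2) powr (p / 2) = ((a / b) powr 2) powr (p / 2)"
    using ab by (simp add: power_divide)
  then show ?thesis by (simp only: powr_powr) simp
qed

text \<open>Here \<open>r\<close>, \<open>x\<close> and \<open>\<rho>\<close> stand for
  \<open>cmod (z * w)\<close>, \<open>Re (z * w)\<close> and half of the sum of squares. For fixed
  \<open>x\<close> the harmonic expression increases with \<open>r\<close>, so
  \<open>r = \<rho>\<close> is the worst case. Writing \<open>x = \<rho> * cos t\<close>, that case
  is \<open>\<rho> powr s\<close> times \<open>cos_powr_ge\<close> at \<open>t / 2\<close>.\<close>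

lemma pointwise_bound_lt_2:
  assumes p: "1 < p" "p < 2" and r: "0 < r" "\<bar>x\<bar> \<le> r" "r \<le> \<rho>"
  shows "\<rho> powr (p / 2) + tan (pi / (2 * p)) * (r powr (p / 2) * cos (p / 2 * arccos (x / r)))
     \<le> ((\<rho> + x) / (1 - \<bar>cos (pi / p)\<bar>)) powr (p / 2)"
proof -
  define x0 where "x0 = pi / (2 * p)"
  have x0: "0 < x0" "x0 < pi / 2" using p by (auto simp: x0_def field_simps)
  have tan0: "0 < tan x0" using x0 by (intro tan_gt_zero) auto
  define s where "s = p / 2"
  have s: "0 < s" "s < 1" using p by (auto simp: s_def)
  have "r powr s * cos (s * arccos (x / r)) \<le> \<rho> powr s * cos (s * arccos (x / \<rho>))"
  proof (rule DERIV_nonneg_imp_increasing_open[OF r(3), of "\<lambda>r. r powr s * cos (s * arccos (x / r))"])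
    fix t assume t: "r < t" "t < \<rho>"
    then have xt: "\<bar>x\<bar> < t" using r by simp
    have a: "0 \<le> arccos (x / t)" "arccos (x / t) \<le> pi"
      using xt r by (auto intro!: arccos_lbound arccos_ubound simp: field_simps)
    have "(1 - s) * arccos (x / t) \<le> 1 * pi"
      using a s by (intro mult_mono) auto
    then have "0 \<le> s * t powr (s - 1) * (sin ((1 - s) * arccos (x / t)) / sin (arccos (x / t)))"
      using a s by (intro mult_nonneg_nonneg divide_nonneg_nonneg sin_ge_zero) auto
    then show "\<exists>y. ((\<lambda>r. r powr s * cos (s * arccos (x / r))) has_real_derivative y) (at t) \<and> 0 \<le> y"
      using powr_cos_arccos_deriv[OF xt, of s] by blast
  qed (use continuous_on_powr_cos_arccos[OF s(1) r(1,2)] in auto)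
  then have "\<rho> powr s + tan x0 * (r powr s * cos (s * arccos (x / r)))
      \<le> \<rho> powr s + tan x0 * (\<rho> powr s * cos (s * arccos (x / \<rho>)))"
    using tan0 by (intro add_left_mono mult_left_mono) auto
  also have "\<dots> \<le> ((\<rho> + x) / (1 - \<bar>cos (pi / p)\<bar>)) powr s"
  proof -
    define t where "t = arccos (x / \<rho>)"
    have \<rho>: "0 < \<rho>" "- 1 \<le> x / \<rho>" "x / \<rho> \<le> 1" using r by (auto simp: field_simps)
    have t: "0 \<le> t" "t \<le> pi" "x / \<rho> = cos t"
      using \<rho> by (auto simp: t_def arccos_lbound arccos_ubound)
    \<comment> \<open>For \<open>p < 2\<close> the cosine of \<open>pi / p\<close> is nonpositive,
      so the constant is \<open>1 + cos (2 * x0)\<close>, the double-angle form that matches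
      \<open>1 + cos t\<close>.\<close>
    have "cos (pi / p) \<le> cos (pi / 2)"
      using p by (intro cos_monotone_0_pi_le) (auto simp: field_simps)
    then have "1 - \<bar>cos (pi / p)\<bar> = 1 + cos (2 * x0)" by (simp add: x0_def)
    then have c: "1 - \<bar>cos (pi / p)\<bar> = 2 * (cos x0)\<^sup>2" by (simp add: cos_double_cos)
    have "1 + cos t = 2 * (cos (t / 2))\<^sup>2"
      using cos_double_cos[of "t / 2"] by simp
    moreover have "\<rho> + x = \<rho> * (1 + cos t)"
      using \<rho> t(3) by (simp add: field_simps)
    ultimately have "(\<rho> + x) / (1 - \<bar>cos (pi / p)\<bar>) = \<rho> * (2 * (cos (t / 2))\<^sup>2 / (2 * (cos x0)\<^sup>2))"
      unfolding c by simp
    then have eq: "((\<rho> + x) / (1 - \<bar>cos (pi / p)\<bar>)) powr s = \<rho> powr s * (cos (t / 2) / cos x0) powr p"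
      unfolding s_def using \<rho> t x0
      by (simp add: powr_mult powr_quotient_sq cos_ge_zero del: times_divide_eq_right)
    have "1 + tan x0 * cos (s * t) \<le> (cos (t / 2) / cos x0) powr p"
      using cos_powr_ge[OF p, of "t / 2"] t by (simp add: x0_def s_def)
    then have "\<rho> powr s * (1 + tan x0 * cos (s * t)) \<le> \<rho> powr s * (cos (t / 2) / cos x0) powr p"
      by (intro mult_left_mono) auto
    then show ?thesis unfolding eq t_def by (simp add: algebra_simps)
  qed
  finally show ?thesis by (simp add: s_def x0_def)
qed

text \<open>This will be applied to \<open>- (z * w)\<close>, whence \<open>\<rho> - x\<close>. The
  diagonal \<open>r = \<rho>\<close> comes from \<open>sin_powr_ge\<close>. The passage from
  \<open>r\<close> to \<open>\<rho>\<close> depends on the sign of \<open>x\<close>: for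
  \<open>x >= 0\<close> the function \<open>g\<close> increases, and for \<open>x < 0\<close> the
  right side grows faster than \<open>\<rho> powr s\<close>.\<close>

lemma pointwise_bound_ge_2:
  assumes p: "2 \<le> p" and r: "0 < r" "\<bar>x\<bar> \<le> r" "r \<le> \<rho>"
  shows "\<rho> powr (p / 2) - cot (pi / (2 * p)) * (r powr (p / 2) * cos (min (p / 2 * arccos (x / r)) pi))
     \<le> ((\<rho> - x) / (1 - \<bar>cos (pi / p)\<bar>)) powr (p / 2)"
proof -
  define x0 where "x0 = pi / (2 * p)"
  have pp: "pi / p \<le> pi / 2" using p by (simp add: field_simps)
  have x0: "0 < x0" "x0 < pi / p" using p by (auto simp: x0_def field_simps)
  have "x0 < pi / 2" using x0 pp by linarith
  then have cs0: "0 < cos x0" "0 < sin x0"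
    using x0 by (auto intro: cos_gt_zero sin_gt_zero2)
  then have cot0: "0 < cot x0" by (simp add: cot_def)
  define s where "s = p / 2"
  have s: "1 \<le> s" using p by (auto simp: s_def)
  define C where "C = 1 - \<bar>cos (pi / p)\<bar>"
  have C: "0 < C" "C \<le> 1" using one_minus_abs_cos_pi_div[of p] p by (auto simp: C_def)
  define g where "g r = - (r powr s * cos (min (s * arccos (x / r)) pi))" for r
  have diag: "\<sigma> powr s + cot x0 * g \<sigma> \<le> ((\<sigma> - x) / C) powr s" if \<sigma>: "r \<le> \<sigma>" for \<sigma>
  proof -
    define t where "t = arccos (x / \<sigma>)"
    have \<sigma>': "0 < \<sigma>" "- 1 \<le> x / \<sigma>" "x / \<sigma> \<le> 1" using r \<sigma> by (auto simp: field_simps)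
    have t: "0 \<le> t" "t \<le> pi" "x / \<sigma> = cos t"
      using \<sigma>' by (auto simp: t_def arccos_lbound arccos_ubound)
    have "cos (pi / p) \<ge> 0"
      using pp x0 by (intro cos_ge_zero) linarith+
    then have "C = 1 - cos (2 * x0)" by (simp add: x0_def C_def)
    then have c: "C = 2 * (sin x0)\<^sup>2" by (simp add: cos_double_sin)
    have "1 - cos t = 2 * (sin (t / 2))\<^sup>2"
      using cos_double_sin[of "t / 2"] by simp
    moreover have "\<sigma> - x = \<sigma> * (1 - cos t)"
      using \<sigma>' t(3) by (simp add: field_simps)
    ultimately have "(\<sigma> - x) / C = \<sigma> * (2 * (sin (t / 2))\<^sup>2 / (2 * (sin x0)\<^sup>2))"
      unfolding c by simp
    then have eq: "((\<sigma> - x) / C) powr s = \<sigma> powr s * (sin (t / 2) / sin x0) powr p"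
      unfolding s_def using \<sigma>' t cs0
      by (simp add: powr_mult powr_quotient_sq sin_ge_zero del: times_divide_eq_right)
    have "1 - cot x0 * cos (min (s * t) pi) \<le> (sin (t / 2) / sin x0) powr p"
    proof (cases "s * t \<le> pi")
      case True
      then show ?thesis
        using sin_powr_ge[OF p, of "t / 2"] t p by (simp add: x0_def s_def field_simps min_def)
    next
      case False
      \<comment> \<open>Past the truncation the left side is frozen at its value for
        \<open>t / 2 = pi / p\<close>, while \<open>sin (t / 2)\<close> keeps growing.\<close>
      have "1 - cot x0 * cos (min (s * t) pi) = 1 - cot x0 * cos (p * (pi / p))"
        using False p by simp
      also have "\<dots> \<le> (sin (pi / p) / sin x0) powr p"
        using sin_powr_ge[OF p, of "pi / p"] p by (simp add: x0_def)
      also have "\<dots> \<le> (sin (t / 2) / sin x0) powr p"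
      proof (rule powr_mono2)
        have "pi / p \<le> t / 2" using False p by (simp add: s_def field_simps)
        then have "sin (pi / p) \<le> sin (t / 2)"
          using t p pp by (intro sin_monotone_2pi_le) (auto intro: order_trans[of _ 0])
        then show "sin (pi / p) / sin x0 \<le> sin (t / 2) / sin x0"
          using cs0 by (simp add: divide_right_mono)
        show "0 \<le> sin (pi / p) / sin x0"
          using cs0 p by (intro divide_nonneg_pos sin_ge_zero) (auto simp: field_simps)
      qed (use p in auto)
      finally show ?thesis .
    qed
    then have "\<sigma> powr s * (1 - cot x0 * cos (min (s * t) pi)) \<le> \<sigma> powr s * (sin (t / 2) / sin x0) powr p"
      by (intro mult_left_mono) auto
    then show ?thesis unfolding eq g_def t_def by (simp add: algebra_simps)
  qed
  have "\<rho> powr s + cot x0 * g r \<le> ((\<rho> - x) / C) powr s"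
  proof (cases "0 \<le> x")
    case True
    have "g r \<le> g \<rho>"
    proof (cases "s * arccos (x / \<rho>) \<le> pi")
      case False
      then have "g \<rho> = \<rho> powr s" by (simp add: g_def)
      moreover have "g r \<le> r powr s * 1"
        unfolding g_def minus_mult_right
        by (intro mult_left_mono) (auto simp: minus_le_iff)
      moreover have "r powr s \<le> \<rho> powr s"
        using r s by (intro powr_mono2) auto
      ultimately show ?thesis by linarith
    next
      case le: True
      \<comment> \<open>For \<open>x >= 0\<close> the angle \<open>arccos (x / t)\<close> grows with
        \<open>t\<close>. Being below the truncation at \<open>\<rho>\<close> therefore means being
        below it on the whole interval, where the derivative formula applies.\<close>
      have a: "0 \<le> arccos (x / t)" "s * arccos (x / t) \<le> pi" if t: "r \<le> t" "t \<le> \<rho>" for t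
      proof -
        have "x / \<rho> \<le> x / t"
          using t True r by (intro divide_left_mono) auto
        moreover have "- 1 \<le> x / \<rho>" "x / t \<le> 1" "- 1 \<le> x / t"
          using t True r by (auto simp: field_simps)
        ultimately have "arccos (x / t) \<le> arccos (x / \<rho>)" "0 \<le> arccos (x / t)"
          by (auto intro: arccos_le_arccos arccos_lbound)
        then show "0 \<le> arccos (x / t)" "s * arccos (x / t) \<le> pi"
          using s mult_left_mono[of "arccos (x / t)" "arccos (x / \<rho>)" s] le by linarith+
      qed
      have "r powr s * cos (s * arccos (x / r)) \<ge> \<rho> powr s * cos (s * arccos (x / \<rho>))"
      proof (rule DERIV_nonpos_imp_decreasing_open[OF r(3), of "\<lambda>r. r powr s * cos (s * arccos (x / r))"])
        fix t assume t: "r < t" "t < \<rho>"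
        then have xt: "\<bar>x\<bar> < t" using r by simp
        have at: "0 \<le> arccos (x / t)" "s * arccos (x / t) \<le> pi" using a t by auto
        have "arccos (x / t) \<le> s * arccos (x / t)" using at s by (simp add: mult_le_cancel_right1)
        then have "arccos (x / t) \<le> pi" using at by simp
        then have "0 \<le> s * t powr (s - 1) * (sin ((s - 1) * arccos (x / t)) / sin (arccos (x / t)))"
          using at s by (intro mult_nonneg_nonneg divide_nonneg_nonneg sin_ge_zero) (auto simp: algebra_simps)
        also have "(s - 1) * arccos (x / t) = - ((1 - s) * arccos (x / t))" by (simp add: algebra_simps)
        finally have "s * t powr (s - 1) * (sin ((1 - s) * arccos (x / t)) / sin (arccos (x / t))) \<le> 0"
          by simp
        then show "\<exists>y. ((\<lambda>r. r powr s * cos (s * arccos (x / r))) has_real_derivative y) (at t) \<and> y \<le> 0"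
          using powr_cos_arccos_deriv[OF xt, of s] by blast
      qed (use continuous_on_powr_cos_arccos[of s r x \<rho>] r s in auto)
      then show ?thesis using a[of r] a[of \<rho>] r by (simp add: g_def min_absorb1)
    qed
    then have "\<rho> powr s + cot x0 * g r \<le> \<rho> powr s + cot x0 * g \<rho>"
      using cot0 by (intro add_left_mono mult_left_mono) auto
    also have "\<dots> \<le> ((\<rho> - x) / C) powr s" using diag r by simp
    finally show ?thesis .
  next
    case False
    \<comment> \<open>Since \<open>C <= 1\<close> and \<open>x < 0\<close>,
      \<open>(t - x) / C\<close> is at least \<open>t\<close> and grows at least as fast, and
      \<open>s >= 1\<close>. So the diagonal case at \<open>r\<close> itself suffices, with
      \<open>g r\<close> unchanged.\<close>
    have "((r - x) / C) powr s - r powr s \<le> ((\<rho> - x) / C) powr s - \<rho> powr s"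
    proof (rule DERIV_nonneg_imp_nondecreasing[OF r(3), of "\<lambda>t. ((t - x) / C) powr s - t powr s"])
      fix t assume t: "r \<le> t" "t \<le> \<rho>"
      have tx: "0 < t" "t \<le> (t - x) / C"
      proof -
        show "0 < t" using r t by simp
        then have "t * C \<le> t" using C by simp
        then have "t * C \<le> t - x" using False by linarith
        then show "t \<le> (t - x) / C" using C by (simp add: field_simps)
      qed
      have "((\<lambda>t. ((t - x) / C) powr s - t powr s) has_real_derivative
          s * ((t - x) / C) powr (s - 1) * (1 / C) - s * t powr (s - 1)) (at t)"
        using tx C by (auto intro!: derivative_eq_intros)
      moreover have "t powr (s - 1) * 1 \<le> ((t - x) / C) powr (s - 1) * (1 / C)"
        using tx s C by (intro mult_mono powr_mono2) auto
      then have "0 \<le> s * ((t - x) / C) powr (s - 1) * (1 / C) - s * t powr (s - 1)"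
        using s mult_left_mono[of "t powr (s - 1) * 1" "((t - x) / C) powr (s - 1) * (1 / C)" s]
        by (simp add: mult.assoc)
      ultimately show "\<exists>y. ((\<lambda>t. ((t - x) / C) powr s - t powr s) has_real_derivative y) (at t) \<and> 0 \<le> y"
        by blast
    qed
    then show ?thesis using diag[of r] by simp
  qed
  then show ?thesis by (simp add: g_def s_def C_def x0_def)
qed

subsection \<open>Homogeneous functions with harmonic supports\<close>

lemma supported_below_cmult:
  assumes "supported_below v" "0 \<le> c"
  shows "supported_below (\<lambda>u. c * v u)"
  unfolding supported_below_def
proof safe
  fix u :: complex assume "u \<noteq> 0"
  then obtain F where F: "F analytic_on {u}" "Re (F u) = v u" "\<forall>\<^sub>F w in nhds u. Re (F w) \<le> v w"
    using assms(1) unfolding supported_below_def by blast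
  have "(\<lambda>w. of_real c * F w) analytic_on {u}" by (intro analytic_intros F)
  moreover have "\<forall>\<^sub>F w in nhds u. Re (of_real c * F w) \<le> c * v w"
    using F(3) by eventually_elim (simp add: mult_left_mono assms(2))
  ultimately show "\<exists>F. F analytic_on {u} \<and> Re (F u) = c * v u \<and> (\<forall>\<^sub>F w in nhds u. Re (F w) \<le> c * v w)"
    using F(2) by (intro exI[of _ "\<lambda>w. of_real c * F w"]) simp
qed

lemma supported_below_uminus:
  assumes "supported_below v"
  shows "supported_below (\<lambda>u. v (- u))"
  unfolding supported_below_def
proof safe
  fix u :: complex assume "u \<noteq> 0"
  then obtain F where F: "F analytic_on {- u}" "Re (F (- u)) = v (- u)"
      "\<forall>\<^sub>F w in nhds (- u). Re (F w) \<le> v w"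
    using assms(1) unfolding supported_below_def by (metis neg_equal_0_iff_equal)
  have "F \<circ> uminus analytic_on {u}"
    using F(1) by (intro analytic_on_compose analytic_intros) auto
  then have "(\<lambda>w. F (- w)) analytic_on {u}" by (simp add: o_def)
  moreover have "filterlim uminus (nhds (- u)) (nhds u)"
    by (intro tendsto_intros) (simp add: filterlim_ident)
  then have "\<forall>\<^sub>F w in nhds u. Re (F (- w)) \<le> v (- w)"
    using F(3) unfolding filterlim_iff by blast
  ultimately show "\<exists>F. F analytic_on {u} \<and> Re (F u) = v (- u) \<and> (\<forall>\<^sub>F w in nhds u. Re (F w) \<le> v (- w))"
    using F(2) by (intro exI[of _ "\<lambda>w. F (- w)"]) simp
qed

section \<open>The absolute value of the argument\<close>

lemma abs_Arg_eq_arccos: "u \<noteq> 0 \<Longrightarrow> \<bar>Arg u\<bar> = arccos (Re u / cmod u)"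
proof -
  assume "u \<noteq> 0"
  then have "Re u / cmod u = cos \<bar>Arg u\<bar>"
    by (simp add: cos_Arg)
  moreover have "arccos (cos \<bar>Arg u\<bar>) = \<bar>Arg u\<bar>"
    using Arg_bounded[of u] by (intro arccos_cos) auto
  ultimately show ?thesis by simp
qed

lemma abs_Arg_minus:
  assumes "u \<noteq> 0"
  shows "\<bar>Arg (- u)\<bar> = pi - \<bar>Arg u\<bar>"
proof -
  have "Re u / cmod u = cos (Arg u)" using assms by (simp add: cos_Arg)
  then have "- 1 \<le> Re u / cmod u" "Re u / cmod u \<le> 1" by simp_all
  then show ?thesis using assms by (simp add: abs_Arg_eq_arccos arccos_minus)
qed

text \<open>The triangle inequality for angles: arguments add as long as their absolute values sum
  to less than \<open>pi\<close>, and otherwise the bound is trivial.\<close>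

lemma abs_Arg_mult_le: "\<bar>Arg (u * w)\<bar> \<le> \<bar>Arg u\<bar> + \<bar>Arg w\<bar>"
proof (cases "u = 0 \<or> w = 0 \<or> pi \<le> \<bar>Arg u\<bar> + \<bar>Arg w\<bar>")
  case True
  then show ?thesis using Arg_bounded[of "u * w"] by (auto simp: Arg_zero)
next
  case False
  then have "Arg (u * w) = Arg u + Arg w"
    by (intro Arg_times) auto
  then show ?thesis by simp
qed

text \<open>\<open>Arg\<close> jumps across the negative real axis, but its absolute value is an
  arccosine of a continuous function.\<close>

lemma continuous_on_abs_Arg: "continuous_on (- {0}) (\<lambda>u. \<bar>Arg u\<bar>)"
proof -
  have "continuous_on (- {0}) (\<lambda>u. arccos (Re u / cmod u))"
    by (intro continuous_intros continuous_on_arccos)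
       (auto simp: divide_le_eq le_divide_eq complex_Re_le_cmod abs_Re_le_cmod
         intro: order_trans[OF _ abs_Re_le_cmod] minus_le_iff[THEN iffD1, OF order_trans[OF _ abs_Re_le_cmod]])
  then show ?thesis
    by (rule continuous_on_cong[THEN iffD1, rotated 2]) (auto simp: abs_Arg_eq_arccos)
qed

text \<open>The angular factor need not have a limit at 0, but it is bounded and
  \<open>cmod u powr s\<close> tends to 0.\<close>

lemma continuous_on_homogeneous:
  assumes "s > 0" "continuous_on UNIV \<phi>" "\<And>t. \<bar>\<phi> t\<bar> \<le> (1::real)"
  shows "continuous_on UNIV (\<lambda>u. cmod u powr s * \<phi> \<bar>Arg u\<bar>)"
proof -
  define f where "f u = cmod u powr s * \<phi> \<bar>Arg u\<bar>" for u
  have 1: "continuous_on (- {0}) f"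
    unfolding f_def
    by (intro continuous_intros continuous_on_compose2[OF assms(2) continuous_on_abs_Arg]) auto
  have "isCont f u" for u
  proof (cases "u = 0")
    case False
    then show ?thesis using 1 continuous_on_eq_continuous_at[of "- {0}" f] by (simp add: open_Compl)
  next
    case True
    have "((\<lambda>u. cmod u powr s) \<longlongrightarrow> cmod 0 powr s) (at 0)"
      using assms(1) by (intro tendsto_intros) auto
    then have "((\<lambda>u. cmod u powr s) \<longlongrightarrow> 0) (at 0)" by simp
    moreover have "\<forall>\<^sub>F u in at 0. norm (f u) \<le> cmod u powr s"
      using mult_left_mono[OF assms(3)] by (intro always_eventually) (auto simp: f_def abs_mult)
    ultimately have "(f \<longlongrightarrow> 0) (at 0)" by (metis Lim_null_comparison)
    then show ?thesis using True by (simp add: isCont_def f_def)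
  qed
  then show ?thesis unfolding f_def by (simp add: continuous_at_imp_continuous_on)
qed

lemma Re_powr_of_real: "Re (u powr of_real s) = cmod u powr s * cos (s * \<bar>Arg u\<bar>)"
proof (cases "u = 0")
  case False
  have "cos (s * \<bar>Arg u\<bar>) = cos (s * Arg u)" by (simp add: abs_if)
  then show ?thesis using False by (simp add: powr_def Re_exp Arg_eq_Im_Ln)
qed simp

text \<open>Dividing by \<open>u\<close> moves the base point to 1, away from the branch cut. This
  gives harmonic candidates for supports at every \<open>u\<close>, including the negative
  axis.\<close>

lemma Re_rotated_powr:
  assumes "u \<noteq> 0"
  shows "Re (of_real (cmod u powr s) * (w / u) powr of_real s) = cmod w powr s * cos (s * \<bar>Arg (w / u)\<bar>)"
  using assms by (simp add: Re_powr_of_real norm_divide powr_divide)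

lemma analytic_on_rotated_powr:
  assumes "u \<noteq> 0"
  shows "(\<lambda>w. of_real c * (w / u) powr of_real s) analytic_on {u}"
  using assms by (intro analytic_intros) auto

text \<open>Off the negative axis the function is locally the real part of a power. At a negative
  \<open>u\<close>, put \<open>b = \<bar>Arg (w / u)\<bar>\<close>; then
  \<open>cos (s * (pi - b))\<close> is \<open>cos (s * pi) * cos (s * b)\<close> plus a nonnegative
  product of sines. Dropping that product leaves the real part of an analytic function, with
  equality at \<open>u\<close>.\<close>

lemma supported_below_lt_1:
  assumes s: "0 < s" "s < 1"
  shows "supported_below (\<lambda>u. cmod u powr s * cos (s * \<bar>Arg u\<bar>))"
  unfolding supported_below_def
proof safe
  fix u :: complex assume u: "u \<noteq> 0"
  show "\<exists>F. F analytic_on {u} \<and> Re (F u) = cmod u powr s * cos (s * \<bar>Arg u\<bar>) \<and>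
     (\<forall>\<^sub>F w in nhds u. Re (F w) \<le> cmod w powr s * cos (s * \<bar>Arg w\<bar>))"
  proof (cases "u \<in> \<real>\<^sub>\<le>\<^sub>0")
    case False
    then show ?thesis
      by (intro exI[of _ "\<lambda>w. w powr of_real s"]) (auto simp: Re_powr_of_real intro!: analytic_intros)
  next
    case True
    define F where "F w = of_real (cos (s * pi) * cmod u powr s) * (w / u) powr of_real s" for w
    have F: "Re (F w) = cmod w powr s * (cos (s * pi) * cos (s * \<bar>Arg (w / u)\<bar>))" for w
      using Re_rotated_powr[OF u, of s w] by (simp add: F_def mult.assoc)
    have "Arg u = pi" using True u by (auto simp: Arg_eq_pi_iff complex_nonpos_Reals_iff complex_is_Real_iff complex_eq_iff)
    then have "Re (F u) = cmod u powr s * cos (s * \<bar>Arg u\<bar>)" using u by (simp add: F)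
    moreover have "Re (F w) \<le> cmod w powr s * cos (s * \<bar>Arg w\<bar>)" for w
    proof (cases "w = 0")
      case False
      have "w / u = - w * of_real (inverse (cmod u))"
        using True u by (auto elim!: nonpos_Reals_cases simp: divide_inverse)
      then have "Arg (w / u) = Arg (- w)" using u by (metis Arg_times_of_real2 inverse_positive_iff_positive zero_less_norm_iff)
      then have a: "\<bar>Arg w\<bar> = pi - \<bar>Arg (w / u)\<bar>" using abs_Arg_minus[OF False] by simp
      have "\<bar>Arg (w / u)\<bar> \<le> pi" using Arg_bounded[of "w / u"] by auto
      then have "s * \<bar>Arg (w / u)\<bar> \<le> 1 * pi" using s by (intro mult_mono) auto
      then have "0 \<le> sin (s * pi) * sin (s * \<bar>Arg (w / u)\<bar>)"
        using s by (intro mult_nonneg_nonneg sin_ge_zero) auto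
      moreover have "cos (s * \<bar>Arg w\<bar>) =
          cos (s * pi) * cos (s * \<bar>Arg (w / u)\<bar>) + sin (s * pi) * sin (s * \<bar>Arg (w / u)\<bar>)"
        unfolding a right_diff_distrib cos_diff ..
      ultimately show ?thesis unfolding F by (intro mult_left_mono) auto
    qed (simp add: F)
    moreover have "F analytic_on {u}"
      unfolding F_def using u by (rule analytic_on_rotated_powr)
    ultimately show ?thesis by (intro exI[of _ F]) auto
  qed
qed

text \<open>In the sector \<open>s * \<bar>Arg u\<bar> < pi\<close> the function is the real part of
  minus a power. Elsewhere it equals \<open>cmod u powr s\<close>, and the rotated power, whose real
  part peaks in the direction of \<open>u\<close>, touches it from below.\<close>

lemma supported_below_ge_1:
  assumes s: "1 \<le> s"
  shows "supported_below (\<lambda>u. cmod u powr s * - cos (min (s * \<bar>Arg u\<bar>) pi))"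
  unfolding supported_below_def
proof safe
  fix u :: complex assume u: "u \<noteq> 0"
  show "\<exists>F. F analytic_on {u} \<and> Re (F u) = cmod u powr s * - cos (min (s * \<bar>Arg u\<bar>) pi) \<and>
     (\<forall>\<^sub>F w in nhds u. Re (F w) \<le> cmod w powr s * - cos (min (s * \<bar>Arg w\<bar>) pi))"
  proof (cases "s * \<bar>Arg u\<bar> < pi")
    case True
    have "\<bar>Arg u\<bar> \<le> s * \<bar>Arg u\<bar>" using s by (simp add: mult_le_cancel_right1)
    then have "Arg u \<noteq> pi" using True by auto
    then have "u \<notin> \<real>\<^sub>\<le>\<^sub>0" using u by (auto simp: Arg_eq_pi complex_nonpos_Reals_iff complex_eq_iff)
    then have "(\<lambda>w. - (w powr of_real s)) analytic_on {u}"
      by (intro analytic_intros) auto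
    \<comment> \<open>Truncation replaces the cosine by its minimum -1, so the inequality holds for
      every \<open>w\<close>, also outside the sector.\<close>
    moreover have "- cos (s * \<bar>Arg w\<bar>) \<le> - cos (min (s * \<bar>Arg w\<bar>) pi)" for w
      by (auto simp: min_def)
    then have "Re (- (w powr of_real s)) \<le> cmod w powr s * - cos (min (s * \<bar>Arg w\<bar>) pi)" for w
      by (simp only: uminus_complex.sel Re_powr_of_real minus_mult_right mult_left_mono powr_ge_zero)
    ultimately show ?thesis using True
      by (intro exI[of _ "\<lambda>w. - (w powr of_real s)"]) (simp add: Re_powr_of_real)
  next
    case False
    define F where "F w = of_real (cmod u powr s) * (w / u) powr of_real s" for w
    have F: "Re (F w) = cmod w powr s * cos (s * \<bar>Arg (w / u)\<bar>)" for w
      unfolding F_def by (rule Re_rotated_powr[OF u])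
    have "isCont (\<lambda>w. \<bar>Arg (w / u)\<bar>) u"
    proof -
      have "continuous_on (- {0}) (\<lambda>w. \<bar>Arg (w / u)\<bar>)"
        by (intro continuous_on_compose2[OF continuous_on_abs_Arg] continuous_intros) (use u in auto)
      then show ?thesis
        using u continuous_on_eq_continuous_at[of "- {0::complex}"] by (auto simp: open_Compl)
    qed
    then have "filterlim (\<lambda>w. \<bar>Arg (w / u)\<bar>) (nhds 0) (nhds u)"
      using u tendsto_at_iff_tendsto_nhds[of "\<lambda>w. \<bar>Arg (w / u)\<bar>" u] by (simp add: isCont_def)
    \<comment> \<open>Close to \<open>u\<close> the angle \<open>s * \<bar>Arg (w / u)\<bar>\<close>
      stays in the range where cosine is decreasing, so a lower bound for it suffices.\<close>
    then have "\<forall>\<^sub>F w in nhds u. \<bar>Arg (w / u)\<bar> < pi / s"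
      using s by (intro order_tendstoD) auto
    moreover have "\<forall>\<^sub>F w in nhds u. w \<in> - {0}"
      using u by (intro eventually_nhds_in_open) (auto simp: open_Compl)
    ultimately have "\<forall>\<^sub>F w in nhds u. Re (F w) \<le> cmod w powr s * - cos (min (s * \<bar>Arg w\<bar>) pi)"
    proof eventually_elim
      case (elim w)
      \<comment> \<open>As \<open>u\<close> lies outside the open sector, going from
        \<open>w\<close> to \<open>u\<close> must cover the angle that \<open>w\<close> lacks to
        reach its edge.\<close>
      have "pi \<le> s * (\<bar>Arg w\<bar> + \<bar>Arg (w / u)\<bar>)"
      proof -
        have "\<bar>Arg (inverse (w / u))\<bar> = \<bar>Arg (w / u)\<bar>" by (simp only: Arg_inverse) simp
        moreover have "u = w * inverse (w / u)" using elim u by simp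
        ultimately have "\<bar>Arg u\<bar> \<le> \<bar>Arg w\<bar> + \<bar>Arg (w / u)\<bar>" by (metis abs_Arg_mult_le)
        then have "s * \<bar>Arg u\<bar> \<le> s * (\<bar>Arg w\<bar> + \<bar>Arg (w / u)\<bar>)"
          using s by (intro mult_left_mono) auto
        then show ?thesis using False by simp
      qed
      then have le: "pi - min (s * \<bar>Arg w\<bar>) pi \<le> s * \<bar>Arg (w / u)\<bar>"
        using s by (simp add: min_def algebra_simps)
      have "cos (s * \<bar>Arg (w / u)\<bar>) \<le> cos (pi - min (s * \<bar>Arg w\<bar>) pi)"
        using elim s le by (intro cos_monotone_0_pi_le) (auto simp: field_simps)
      also have "\<dots> = - cos (min (s * \<bar>Arg w\<bar>) pi)" by simp
      finally show ?case unfolding F by (intro mult_left_mono) auto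
    qed
    moreover have "Re (F u) = cmod u powr s * - cos (min (s * \<bar>Arg u\<bar>) pi)"
      using u False by (simp add: F)
    moreover have "F analytic_on {u}"
      unfolding F_def using u by (rule analytic_on_rotated_powr)
    ultimately show ?thesis by (intro exI[of _ F]) auto
  qed
qed

section \<open>The subharmonic minorant\<close>

lemma norm_add_cnj_powr:
  "cmod (z + cnj w) powr p = (2 * (((cmod z)\<^sup>2 + (cmod w)\<^sup>2) / 2 + Re (z * w))) powr (p / 2)"
proof -
  have "2 * (((cmod z)\<^sup>2 + (cmod w)\<^sup>2) / 2 + Re (z * w)) = (cmod (z + cnj w))\<^sup>2"
    unfolding cmod_power2 by (simp add: power2_eq_square algebra_simps)
  then have "(2 * (((cmod z)\<^sup>2 + (cmod w)\<^sup>2) / 2 + Re (z * w))) powr (p / 2)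
      = (cmod (z + cnj w) powr 2) powr (p / 2)"
    by simp
  then show ?thesis by (simp only: powr_powr) simp
qed

lemma supported_minorant_exists:
  assumes p: "1 < p"
  obtains v where "continuous_on UNIV v" "supported_below v" "v 0 = 0"
    "\<And>u. 0 \<le> Re u \<Longrightarrow> 0 \<le> v u"
    "\<And>z w. ((cmod z)\<^sup>2 + (cmod w)\<^sup>2) powr (p / 2) + v (z * w)
       \<le> cmod (z + cnj w) powr p / (1 - \<bar>cos (pi / p)\<bar>) powr (p / 2)"
proof -
  define s where "s = p / 2"
  define C where "C = 1 - \<bar>cos (pi / p)\<bar>"
  have C: "0 < C" "C \<le> 1" using one_minus_abs_cos_pi_div[OF p] by (auto simp: C_def)
  have s: "0 < s" using p by (simp add: s_def)
  have x0: "0 < pi / (2 * p)" "pi / (2 * p) < pi / 2" using p by (auto simp: field_simps)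
  \<comment> \<open>The pointwise bounds use half of the sum of squares, so both sides are
    multiplied by \<open>2 powr s\<close>. If \<open>z * w = 0\<close>, those bounds do not apply,
    but then \<open>V = 0\<close> and \<open>C <= 1\<close> is enough.\<close>
  have transfer: "((cmod z)\<^sup>2 + (cmod w)\<^sup>2) powr s + 2 powr s * V \<le> cmod (z + cnj w) powr p / C powr s"
    if "z * w = 0 \<Longrightarrow> V = 0"
      "z * w \<noteq> 0 \<Longrightarrow> (((cmod z)\<^sup>2 + (cmod w)\<^sup>2) / 2) powr s + V
        \<le> ((((cmod z)\<^sup>2 + (cmod w)\<^sup>2) / 2 + Re (z * w)) / C) powr s" for z w V
  proof -
    define \<rho> where "\<rho> = ((cmod z)\<^sup>2 + (cmod w)\<^sup>2) / 2"
    have \<rho>: "0 \<le> \<rho>" by (simp add: \<rho>_def)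
    have \<rho>': "0 \<le> \<rho> + Re (z * w)"
    proof -
      have "2 * (\<rho> + Re (z * w)) = (cmod (z + cnj w))\<^sup>2"
        unfolding \<rho>_def cmod_power2 by (simp add: power2_eq_square algebra_simps)
      then have "0 \<le> 2 * (\<rho> + Re (z * w))" by (simp only: zero_le_power2)
      then show ?thesis by (simp only: zero_le_mult_iff) linarith
    qed
    have *: "\<rho> powr s + V \<le> ((\<rho> + Re (z * w)) / C) powr s"
    proof (cases "z * w = 0")
      case True
      have "\<rho> * C \<le> \<rho>" using C \<rho> by (simp add: mult_left_le)
      then have "\<rho> \<le> \<rho> / C" using C by (simp add: field_simps)
      then have "\<rho> powr s \<le> (\<rho> / C) powr s" using \<rho> s by (intro powr_mono2) auto
      then show ?thesis using that(1) True by auto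
    qed (use that(2) in \<open>simp add: \<rho>_def\<close>)
    have "(2 * \<rho>) powr s + 2 powr s * V = 2 powr s * (\<rho> powr s + V)"
      using \<rho> by (simp add: powr_mult algebra_simps)
    also have "\<dots> \<le> 2 powr s * ((\<rho> + Re (z * w)) / C) powr s"
      using * by (intro mult_left_mono) auto
    also have "\<dots> = (2 * (\<rho> + Re (z * w))) powr s / C powr s"
    proof -
      have "(2 * Y) powr s / C powr s = 2 powr s * (Y / C) powr s" if "0 \<le> Y" for Y
        using that C by (simp add: powr_divide powr_mult)
      from this[OF \<rho>'] show ?thesis by (rule sym)
    qed
    finally have "(2 * \<rho>) powr s + 2 powr s * V \<le> (2 * (\<rho> + Re (z * w))) powr s / C powr s" .
    moreover have "(2 * (\<rho> + Re (z * w))) powr s / C powr s = cmod (z + cnj w) powr p / C powr s"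
      unfolding norm_add_cnj_powr by (simp add: \<rho>_def s_def)
    moreover have "2 * \<rho> = (cmod z)\<^sup>2 + (cmod w)\<^sup>2" by (simp add: \<rho>_def)
    ultimately show ?thesis by (simp only:)
  qed
  have amgm: "cmod (z * w) \<le> ((cmod z)\<^sup>2 + (cmod w)\<^sup>2) / 2" for z w
    using zero_le_power2[of "cmod z - cmod w"] by (simp add: norm_mult power2_diff)
  show thesis
  proof (cases "p < 2")
    case True
    define c where "c = tan (pi / (2 * p))"
    have c: "0 < c" unfolding c_def using x0 by (intro tan_gt_zero) auto
    define v where "v u = 2 powr s * c * (cmod u powr s * cos (s * \<bar>Arg u\<bar>))" for u
    show thesis
    proof (rule that)
      show "continuous_on UNIV v"
        unfolding v_def
        by (intro continuous_on_mult_left continuous_on_homogeneous[where \<phi> = "\<lambda>t. cos (s * t)"] s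
            continuous_on_cos continuous_on_id) simp
      show "supported_below v"
        unfolding v_def using c s True
        by (intro supported_below_cmult supported_below_lt_1) (auto simp: s_def)
      show "v 0 = 0" by (simp add: v_def)
      show "0 \<le> v u" if "0 \<le> Re u" for u
      proof -
        have "\<bar>Arg u\<bar> \<le> pi / 2" using that Arg_Re_nonneg by blast
        then have "s * \<bar>Arg u\<bar> \<le> 1 * (pi / 2)" using s True by (intro mult_mono) (auto simp: s_def)
        moreover have "0 \<le> s * \<bar>Arg u\<bar>" using s by simp
        ultimately have "0 \<le> cos (s * \<bar>Arg u\<bar>)" by (intro cos_ge_zero) linarith+
        then show ?thesis using c by (simp add: v_def)
      qed
      show "((cmod z)\<^sup>2 + (cmod w)\<^sup>2) powr (p / 2) + v (z * w)
         \<le> cmod (z + cnj w) powr p / (1 - \<bar>cos (pi / p)\<bar>) powr (p / 2)" for z w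
      proof -
        have "((cmod z)\<^sup>2 + (cmod w)\<^sup>2) powr s + 2 powr s * (c * (cmod (z * w) powr s * cos (s * \<bar>Arg (z * w)\<bar>)))
            \<le> cmod (z + cnj w) powr p / C powr s"
        proof (rule transfer)
          assume nz: "z * w \<noteq> 0"
          then have "0 < cmod (z * w)" by (simp only: zero_less_norm_iff not_False_eq_True)
          from pointwise_bound_lt_2[OF p True this abs_Re_le_cmod amgm]
          show "(((cmod z)\<^sup>2 + (cmod w)\<^sup>2) / 2) powr s + c * (cmod (z * w) powr s * cos (s * \<bar>Arg (z * w)\<bar>))
              \<le> ((((cmod z)\<^sup>2 + (cmod w)\<^sup>2) / 2 + Re (z * w)) / C) powr s"
            unfolding abs_Arg_eq_arccos[OF nz] s_def c_def C_def .
        qed simp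
        then show ?thesis unfolding v_def s_def C_def by (simp only: mult.assoc)
      qed
    qed
  next
    case False
    define c where "c = cot (pi / (2 * p))"
    have c: "0 < c" unfolding c_def cot_def using x0 p by (intro divide_pos_pos cos_gt_zero sin_gt_zero2) auto
    \<comment> \<open>The reflection matches the bound with \<open>\<rho> - x\<close>. It also gives
      nonnegativity: for \<open>u\<close> nonzero in the right half plane
      \<open>\<bar>Arg (- u)\<bar>\<close> is at least \<open>pi / 2\<close>, so the truncated angle
      lies between \<open>pi / 2\<close> and \<open>pi\<close>.\<close>
    define v where "v u = 2 powr s * c * (cmod (- u) powr s * - cos (min (s * \<bar>Arg (- u)\<bar>) pi))" for u
    show thesis
    proof (rule that)
      have "continuous_on UNIV (\<lambda>u. cmod u powr s * - cos (min (s * \<bar>Arg u\<bar>) pi))"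
      proof (rule continuous_on_homogeneous[where \<phi> = "\<lambda>t. - cos (min (s * t) pi)", OF s])
        show "continuous_on UNIV (\<lambda>t. - cos (min (s * t) pi))"
          by (intro continuous_intros)
      qed simp
      then have "continuous_on UNIV (\<lambda>u. cmod (- u) powr s * - cos (min (s * \<bar>Arg (- u)\<bar>) pi))"
        by (rule continuous_on_compose2[of UNIV _ UNIV uminus]) (simp_all add: continuous_on_minus)
      then show "continuous_on UNIV v"
        unfolding v_def by (rule continuous_on_mult_left)
      show "supported_below v"
        unfolding v_def
        using c s False supported_below_uminus[OF supported_below_ge_1[of s]]
        by (intro supported_below_cmult) (auto simp: s_def)
      show "v 0 = 0" by (simp add: v_def)
      show "0 \<le> v u" if "0 \<le> Re u" for u
      proof (cases "u = 0")
        case nz: False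
        have "\<bar>Arg u\<bar> \<le> pi / 2" using that Arg_Re_nonneg by blast
        then have "pi / 2 \<le> \<bar>Arg (- u)\<bar>" using abs_Arg_minus[OF nz] by linarith
        then have "1 * (pi / 2) \<le> s * \<bar>Arg (- u)\<bar>" using s False by (intro mult_mono) (auto simp: s_def)
        then have "cos (min (s * \<bar>Arg (- u)\<bar>) pi) \<le> cos (pi / 2)"
          by (intro cos_monotone_0_pi_le) auto
        then have "0 \<le> - cos (min (s * \<bar>Arg (- u)\<bar>) pi)" by simp
        then show ?thesis unfolding v_def using c by (intro mult_nonneg_nonneg) auto
      qed (simp add: v_def)
      show "((cmod z)\<^sup>2 + (cmod w)\<^sup>2) powr (p / 2) + v (z * w)
         \<le> cmod (z + cnj w) powr p / (1 - \<bar>cos (pi / p)\<bar>) powr (p / 2)" for z w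
      proof -
        have "((cmod z)\<^sup>2 + (cmod w)\<^sup>2) powr s
            + 2 powr s * (c * (cmod (- (z * w)) powr s * - cos (min (s * \<bar>Arg (- (z * w))\<bar>) pi)))
            \<le> cmod (z + cnj w) powr p / C powr s"
        proof (rule transfer)
          assume nz: "z * w \<noteq> 0"
          then have nz': "- (z * w) \<noteq> 0" by (simp only: neg_equal_0_iff_equal not_False_eq_True)
          then have pos: "0 < cmod (- (z * w))" by (simp only: zero_less_norm_iff not_False_eq_True)
          have p2: "2 \<le> p" using False by simp
          have le: "cmod (- (z * w)) \<le> ((cmod z)\<^sup>2 + (cmod w)\<^sup>2) / 2"
            using amgm[of z w] by (simp only: norm_minus_cancel)
          from pointwise_bound_ge_2[OF p2 pos abs_Re_le_cmod le]
          show "(((cmod z)\<^sup>2 + (cmod w)\<^sup>2) / 2) powr s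
              + c * (cmod (- (z * w)) powr s * - cos (min (s * \<bar>Arg (- (z * w))\<bar>) pi))
              \<le> ((((cmod z)\<^sup>2 + (cmod w)\<^sup>2) / 2 + Re (z * w)) / C) powr s"
            unfolding abs_Arg_eq_arccos[OF nz'] s_def c_def C_def
            by (simp only: mult_minus_right uminus_complex.sel diff_minus_eq_add add_uminus_conv_diff)
        qed simp
        then show ?thesis unfolding v_def s_def C_def by (simp only: mult.assoc)
      qed
    qed
  qed
qed

subsection \<open>Integration over the disc\<close>

lemma weighted_area_eq:
  "weighted_area \<alpha> = density (restrict_space lborel unit_disc)
     (\<lambda>z. ennreal ((\<alpha> + 1) / pi * (1 - (cmod z)\<^sup>2) powr \<alpha>))"
proof (rule measure_eqI)
  fix A assume "A \<in> sets (weighted_area \<alpha>)"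
  then have A: "A \<in> sets (restrict_space lborel unit_disc)"
    by (simp add: weighted_area_def disc_area_def)
  have "(\<lambda>z::complex. ennreal ((\<alpha> + 1) * (1 - (cmod z)\<^sup>2) powr \<alpha>)) \<in> borel_measurable lborel"
    "(\<lambda>z::complex. ennreal ((\<alpha> + 1) / pi * (1 - (cmod z)\<^sup>2) powr \<alpha>)) \<in> borel_measurable lborel"
    by measurable
  note meas = this[THEN measurable_restrict_space1, of unit_disc]
  have eq: "ennreal (1 / pi) * ennreal ((\<alpha> + 1) * (1 - (cmod z)\<^sup>2) powr \<alpha>) =
      ennreal ((\<alpha> + 1) / pi * (1 - (cmod z)\<^sup>2) powr \<alpha>)" for z
    by (subst ennreal_mult'[symmetric]) auto
  have "emeasure (weighted_area \<alpha>) A =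
      ennreal (1 / pi) * (\<integral>\<^sup>+z. ennreal ((\<alpha> + 1) * (1 - (cmod z)\<^sup>2) powr \<alpha>) * indicator A z
        \<partial>restrict_space lborel unit_disc)"
    unfolding weighted_area_def disc_area_def
    using A meas(1) by (subst emeasure_density) (auto simp: nn_integral_scale_measure)
  also have "\<dots> = (\<integral>\<^sup>+z. ennreal ((\<alpha> + 1) / pi * (1 - (cmod z)\<^sup>2) powr \<alpha>) * indicator A z
        \<partial>restrict_space lborel unit_disc)"
    using A meas(1) by (subst nn_integral_cmult[symmetric]) (auto simp: mult.assoc[symmetric] eq)
  also have "\<dots> = emeasure (density (restrict_space lborel unit_disc)
     (\<lambda>z. ennreal ((\<alpha> + 1) / pi * (1 - (cmod z)\<^sup>2) powr \<alpha>))) A"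
    using A meas(2) by (subst emeasure_density) auto
  finally show "emeasure (weighted_area \<alpha>) A = emeasure (density (restrict_space lborel unit_disc)
     (\<lambda>z. ennreal ((\<alpha> + 1) / pi * (1 - (cmod z)\<^sup>2) powr \<alpha>))) A" .
qed (simp add: weighted_area_def disc_area_def)

lemma space_weighted_area [simp]: "space (weighted_area \<alpha>) = unit_disc"
  by (simp add: weighted_area_eq space_restrict_space)

lemma measurable_weighted_area:
  fixes F :: "complex \<Rightarrow> 'a :: topological_space"
  assumes "continuous_on unit_disc F"
  shows "F \<in> borel_measurable (weighted_area \<alpha>)"
proof -
  have "sets (weighted_area \<alpha>) = sets (restrict_space borel unit_disc)"
    by (simp add: weighted_area_eq sets_restrict_space)
  then show ?thesis
    using borel_measurable_continuous_on_restrict[OF assms] by (simp cong: measurable_cong_sets)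
qed

text \<open>On a disc of radius below 1 the factor \<open>1 - (cmod z)\<^sup>2\<close> stays away
  from 0. So the weight is continuous up to the boundary of that disc even for negative
  \<open>\<alpha>\<close>, and all integrals there are finite.\<close>

lemma
  fixes F :: "complex \<Rightarrow> real"
  assumes F: "continuous_on unit_disc F" and \<alpha>: "- 1 < \<alpha>"
    and r: "r < 1"
  shows integral_weighted_area_ball:
      "(\<integral>z. indicator (ball 0 r) z * F z \<partial>weighted_area \<alpha>) =
       (\<integral>z. indicator (ball 0 r) z * ((\<alpha> + 1) / pi * (1 - (cmod z)\<^sup>2) powr \<alpha> * F z) \<partial>lborel)"
    and integrable_weighted_area_ball:
      "integrable (weighted_area \<alpha>) (\<lambda>z. indicator (ball 0 r) z * F z)"
proof -
  define W where "W z = (\<alpha> + 1) / pi * (1 - (cmod z)\<^sup>2) powr \<alpha>" for z :: complex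
  have sub: "ball 0 r \<subseteq> unit_disc" "cball 0 r \<subseteq> unit_disc" using r by auto
  have [measurable]: "W \<in> borel_measurable borel" unfolding W_def by measurable
  have W0: "0 \<le> W z" for z using \<alpha> by (simp add: W_def)
  have nz: "1 - (cmod z)\<^sup>2 \<noteq> 0" if "z \<in> cball 0 r" for z :: complex
    using that r abs_square_less_1[of "cmod z"] by simp
  have contF: "continuous_on (cball 0 r) (\<lambda>z. W z * F z)"
    unfolding W_def using r
    by (intro continuous_intros continuous_on_subset[OF F sub(2)]) (use nz in auto)
  have set_int: "set_integrable lborel (cball 0 r) (\<lambda>z. W z * F z)"
    unfolding set_integrable_def by (intro borel_integrable_compact contF compact_cball)
  then have "set_integrable lborel (ball 0 r) (\<lambda>z. W z * F z)"
    by (rule set_integrable_subset) auto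
  then have int: "integrable lborel (\<lambda>z. indicator unit_disc z * (W z * (indicator (ball 0 r) z * F z)))"
    unfolding set_integrable_def
    by (rule Bochner_Integration.integrable_cong[THEN iffD1, rotated -1]) (use r in \<open>auto simp: indicator_def\<close>)
  have meas: "(\<lambda>z. indicator (ball 0 r) z * F z) \<in> borel_measurable (restrict_space lborel unit_disc)"
  proof (rule borel_measurable_times)
    show "F \<in> borel_measurable (restrict_space lborel unit_disc)"
      using borel_measurable_continuous_on_restrict[OF F]
      by (simp cong: measurable_cong_sets add: sets_restrict_space)
    show "(indicator (ball 0 r) :: complex \<Rightarrow> real) \<in> borel_measurable (restrict_space lborel unit_disc)"
      by (rule measurable_restrict_space1) (simp add: borel_measurable_indicator)
  qed
  have measW: "W \<in> borel_measurable (restrict_space lborel unit_disc)"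
    by (intro measurable_restrict_space1) simp
  show "integrable (weighted_area \<alpha>) (\<lambda>z. indicator (ball 0 r) z * F z)"
    unfolding weighted_area_eq W_def[symmetric]
    using int meas measW W0
    by (subst integrable_density) (auto simp: integrable_restrict_space)
  have "(\<integral>z. indicator (ball 0 r) z * F z \<partial>weighted_area \<alpha>) =
      (\<integral>z. indicator unit_disc z * (W z * (indicator (ball 0 r) z * F z)) \<partial>lborel)"
    unfolding weighted_area_eq W_def[symmetric]
    using meas measW W0
    by (subst integral_density) (auto simp: integral_restrict_space)
  also have "\<dots> = (\<integral>z. indicator (ball 0 r) z * (W z * F z) \<partial>lborel)"
    using r by (intro Bochner_Integration.integral_cong) (auto simp: indicator_def)
  finally show "(\<integral>z. indicator (ball 0 r) z * F z \<partial>weighted_area \<alpha>) =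
       (\<integral>z. indicator (ball 0 r) z * ((\<alpha> + 1) / pi * (1 - (cmod z)\<^sup>2) powr \<alpha> * F z) \<partial>lborel)"
    unfolding W_def .
qed

text \<open>The weight and the disc are radial, so on each circle the mean is a nonnegative constant
  times the mean of \<open>v o G\<close>, which is at least \<open>v (G 0)\<close>.\<close>

lemma weighted_integral_nonneg:
  assumes v: "continuous_on UNIV v" "supported_below v" "v 0 = 0"
    and G: "G holomorphic_on unit_disc" "0 \<le> v (G 0)" and \<alpha>: "- 1 < \<alpha>" and r: "r < 1"
  shows "0 \<le> (\<integral>z. indicator (ball 0 r) z * v (G z) \<partial>weighted_area \<alpha>)"
proof -
  define W where "W z = (\<alpha> + 1) / pi * (1 - (cmod z)\<^sup>2) powr \<alpha>" for z :: complex
  define u where "u z = indicator (ball 0 r) z * (W z * v (G z))" for z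
  have W0: "0 \<le> W z" for z using \<alpha> by (simp add: W_def)
  have contvG: "continuous_on unit_disc (\<lambda>z. v (G z))"
    using holomorphic_on_imp_continuous_on[OF G(1)] by (intro continuous_on_compose2[OF v(1)]) auto
  have sub: "cball 0 r \<subseteq> unit_disc" using r by auto
  have nz: "1 - (cmod z)\<^sup>2 \<noteq> 0" if "z \<in> cball 0 r" for z :: complex
    using that r abs_square_less_1[of "cmod z"] by simp
  have cont: "continuous_on (cball 0 r) (\<lambda>z. W z * v (G z))"
    unfolding W_def using r
    by (intro continuous_intros continuous_on_subset[OF contvG sub]) (use nz in auto)
  have "bounded ((\<lambda>z. W z * v (G z)) ` cball 0 r)"
    by (intro compact_imp_bounded compact_continuous_image cont compact_cball)
  then obtain B where B: "0 < B" "\<And>z. z \<in> cball 0 r \<Longrightarrow> \<bar>W z * v (G z)\<bar> \<le> B"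
    unfolding bounded_pos by auto
  have "0 \<le> (\<integral>z. u z \<partial>lborel)"
  proof (rule integral_nonneg_if_circle_means_nonneg)
    show "u \<in> borel_measurable borel"
      unfolding u_def
      using borel_measurable_continuous_on_indicator[OF _ continuous_on_subset[OF cont ball_subset_cball]]
      by simp
    show "\<bar>u z\<bar> \<le> B" for z
      using B by (auto simp: u_def indicator_def less_imp_le)
    show "u z = 0" if "r < cmod z" for z
      using that by (simp add: u_def)
    show "0 \<le> (LINT t:{0..2 * pi}|lborel. u (cis t * z))" for z
    proof (cases "cmod z < r")
      case False
      then have "u (cis t * z) = 0" for t by (simp add: u_def norm_mult)
      then show ?thesis by simp
    next
      case True
      have zin: "\<zeta> * z \<in> unit_disc" if "\<zeta> \<in> cball 0 1" for \<zeta>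
        using that True r mult_right_mono[of "cmod \<zeta>" 1 "cmod z"] by (simp add: norm_mult)
      \<comment> \<open>The circle through \<open>z\<close> is rescaled to the unit circle. As
        \<open>cmod z < 1\<close>, the rescaled map is continuous on the closed disc, as
        \<open>supported_submean_circle\<close> requires.\<close>
      have Gz: "(\<lambda>\<zeta>. G (\<zeta> * z)) holomorphic_on ball 0 1"
        by (intro holomorphic_on_compose_gen[OF _ G(1), unfolded o_def] holomorphic_intros) (use zin in auto)
      have Gc: "continuous_on (cball 0 1) (\<lambda>\<zeta>. G (\<zeta> * z))"
        by (intro continuous_on_compose2[OF holomorphic_on_imp_continuous_on[OF G(1)]] continuous_intros)
           (use zin in auto)
      have uc: "u (cis t * z) = W z * v (G (cis t * z))" for t
        using True by (simp add: u_def W_def norm_mult)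
      have cc: "continuous_on {0..2 * pi} (\<lambda>t. W z * v (G (cis t * z)))"
        by (intro continuous_intros continuous_on_compose2[OF v(1)] continuous_on_compose2[OF Gc]) auto
      have "(LINT t:{0..2 * pi}|lborel. u (cis t * z)) = integral {0..2 * pi} (\<lambda>t. W z * v (G (cis t * z)))"
        unfolding uc
        by (intro set_borel_integral_eq_integral, unfold set_integrable_def) (rule borel_integrable_compact[OF compact_Icc cc])
      also have "\<dots> = W z * integral {0..2 * pi} (\<lambda>t. v (G (cis t * z)))"
        by simp
      finally have eq: "(LINT t:{0..2 * pi}|lborel. u (cis t * z)) =
          W z * integral {0..2 * pi} (\<lambda>t. v (G (cis t * z)))" .
      have "0 \<le> 2 * pi * v (G 0)" using G(2) by simp
      also have "\<dots> \<le> integral {0..2 * pi} (\<lambda>t. v (G (cis t * z)))"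
        using supported_submean_circle[OF v Gz Gc] by simp
      finally show ?thesis unfolding eq using W0 by (intro mult_nonneg_nonneg)
    qed
  qed
  also have "(\<integral>z. u z \<partial>lborel) = (\<integral>z. indicator (ball 0 r) z * v (G z) \<partial>weighted_area \<alpha>)"
    unfolding u_def W_def by (rule integral_weighted_area_ball[OF contvG \<alpha> r, symmetric])
  finally show ?thesis .
qed

text \<open>Monotone convergence for nonnegative integrals along radii tending to 1. Uniform bounds
  on the smaller discs thereby give integrability on the whole disc.\<close>

lemma unit_disc_exhaustion:
  fixes \<phi> :: "complex \<Rightarrow> real"
  assumes cont: "continuous_on unit_disc \<phi>" and nonneg: "\<And>z. 0 \<le> \<phi> z" and \<alpha>: "- 1 < \<alpha>"
    and le: "\<And>r. r < 1 \<Longrightarrow> (\<integral>z. indicator (ball 0 r) z * \<phi> z \<partial>weighted_area \<alpha>) \<le> L"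
  shows "integrable (weighted_area \<alpha>) \<phi> \<and> (\<integral>z. \<phi> z \<partial>weighted_area \<alpha>) \<le> L"
proof -
  define r :: "nat \<Rightarrow> real" where "r n = 1 - 1 / (real n + 1)" for n
  have r1: "r n < 1" for n by (simp add: r_def)
  have meas[measurable]: "\<phi> \<in> borel_measurable (weighted_area \<alpha>)"
    by (rule measurable_weighted_area[OF cont])
  have meas': "(\<lambda>z. indicator (ball 0 (r n)) z * \<phi> z) \<in> borel_measurable (weighted_area \<alpha>)" for n
    using integrable_weighted_area_ball[OF cont \<alpha> r1] by (rule borel_measurable_integrable)
  \<comment> \<open>The disc of radius 0 is empty, so its integral is 0.\<close>
  have L: "0 \<le> L"
    using le[of 0] by simp
  have "(\<integral>\<^sup>+z. ennreal (\<phi> z) \<partial>weighted_area \<alpha>)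
      = (\<integral>\<^sup>+z. (SUP n. ennreal (indicator (ball 0 (r n)) z * \<phi> z)) \<partial>weighted_area \<alpha>)"
  proof (rule nn_integral_cong)
    fix z assume "z \<in> space (weighted_area \<alpha>)"
    then have z: "0 < 1 - cmod z" by simp
    obtain n where "1 / real (Suc n) < 1 - cmod z"
      using nat_approx_posE[OF z] by metis
    then have "z \<in> ball 0 (r n)" by (simp add: r_def add.commute)
    then have "ennreal (\<phi> z) \<le> (SUP n. ennreal (indicator (ball 0 (r n)) z * \<phi> z))"
      by (intro SUP_upper2[of n]) auto
    moreover have "(SUP n. ennreal (indicator (ball 0 (r n)) z * \<phi> z)) \<le> ennreal (\<phi> z)"
      using nonneg by (intro SUP_least ennreal_leI) (auto simp: indicator_def)
    ultimately show "ennreal (\<phi> z) = (SUP n. ennreal (indicator (ball 0 (r n)) z * \<phi> z))"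
      by (rule antisym)
  qed
  also have "\<dots> = (SUP n. \<integral>\<^sup>+z. ennreal (indicator (ball 0 (r n)) z * \<phi> z) \<partial>weighted_area \<alpha>)"
  proof (rule nn_integral_monotone_convergence_SUP)
    have "r m \<le> r n" if "m \<le> n" for m n
      using that by (simp add: r_def frac_le)
    then have "r m \<le> r (Suc m)" for m by simp
    then show "incseq (\<lambda>n z. ennreal (indicator (ball 0 (r n)) z * \<phi> z))"
      using nonneg
      by (intro incseq_SucI le_funI ennreal_leI mult_right_mono) (auto simp: indicator_def less_le_trans)
    show "(\<lambda>z. ennreal (indicator (ball 0 (r n)) z * \<phi> z)) \<in> borel_measurable (weighted_area \<alpha>)" for n
      using meas'[of n] by (rule measurable_compose[OF _ measurable_ennreal])
  qed
  also have "\<dots> \<le> ennreal L"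
  proof (rule SUP_least)
    fix n
    have "(\<integral>\<^sup>+z. ennreal (indicator (ball 0 (r n)) z * \<phi> z) \<partial>weighted_area \<alpha>)
       = ennreal (\<integral>z. indicator (ball 0 (r n)) z * \<phi> z \<partial>weighted_area \<alpha>)"
      using nonneg by (intro nn_integral_eq_integral integrable_weighted_area_ball cont \<alpha> r1 AE_I2) auto
    then show "(\<integral>\<^sup>+z. ennreal (indicator (ball 0 (r n)) z * \<phi> z) \<partial>weighted_area \<alpha>) \<le> ennreal L"
      using le[OF r1] by (simp add: ennreal_leI)
  qed
  finally have fin: "(\<integral>\<^sup>+z. ennreal (\<phi> z) \<partial>weighted_area \<alpha>) \<le> ennreal L" .
  then have int: "integrable (weighted_area \<alpha>) \<phi>"
    using nonneg by (intro integrableI_nonneg meas AE_I2) (auto intro: le_less_trans)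
  moreover have "(\<integral>z. \<phi> z \<partial>weighted_area \<alpha>) \<le> L"
    using fin nn_integral_eq_integral[OF int] nonneg L by simp
  ultimately show ?thesis by blast
qed

section \<open>The integral inequality\<close>

theorem lemma1p1:
  fixes p \<alpha> :: real and f h g :: "complex \<Rightarrow> complex"
  assumes "1 < p" and "- 1 < \<alpha>"
    and "f \<in> harmonic_bergman \<alpha> p"
    and "h analytic_on unit_disc" and "g analytic_on unit_disc"
    and "\<And>z. z \<in> unit_disc \<Longrightarrow> f z = h z + cnj (g z)"
    and "Re (g 0 * h 0) \<ge> 0"
  shows "integrable (weighted_area \<alpha>) (\<lambda>z. ((cmod (h z))\<^sup>2 + (cmod (g z))\<^sup>2) powr (p / 2)) \<and>
    (\<integral>z. ((cmod (h z))\<^sup>2 + (cmod (g z))\<^sup>2) powr (p / 2) \<partial>weighted_area \<alpha>) powr (1 / p)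
      \<le> 1 / (1 - \<bar>cos (pi / p)\<bar>) powr (1 / 2)
        * (\<integral>z. cmod (h z + cnj (g z)) powr p \<partial>weighted_area \<alpha>) powr (1 / p)"
proof -
  define M where "M = weighted_area \<alpha>"
  define C where "C = 1 - \<bar>cos (pi / p)\<bar>"
  have C: "0 < C" using one_minus_abs_cos_pi_div[OF assms(1)] by (simp add: C_def)
  define \<phi> where "\<phi> z = ((cmod (h z))\<^sup>2 + (cmod (g z))\<^sup>2) powr (p / 2)" for z
  define \<psi> where "\<psi> z = cmod (h z + cnj (g z)) powr p" for z
  obtain v where v: "continuous_on UNIV v" "supported_below v" "v 0 = 0"
    "\<And>u. 0 \<le> Re u \<Longrightarrow> 0 \<le> v u"
    "\<And>z w. ((cmod z)\<^sup>2 + (cmod w)\<^sup>2) powr (p / 2) + v (z * w) \<le> cmod (z + cnj w) powr p / C powr (p / 2)"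
    using supported_minorant_exists[OF assms(1)] unfolding C_def by blast
  have hol: "h holomorphic_on unit_disc" "g holomorphic_on unit_disc"
    using assms(4,5) by (auto intro: analytic_imp_holomorphic)
  note chg = hol[THEN holomorphic_on_imp_continuous_on]
  have cont: "continuous_on unit_disc \<phi>" "continuous_on unit_disc \<psi>"
    "continuous_on unit_disc (\<lambda>z. v (h z * g z))"
    unfolding \<phi>_def \<psi>_def using assms(1)
    by (intro continuous_intros continuous_on_powr' chg continuous_on_compose2[OF v(1)]; simp)+
  have int\<psi>: "integrable M \<psi>"
  proof -
    have "integrable M (\<lambda>z. cmod (f z) powr p)"
      using assms(3) by (simp add: harmonic_bergman_def M_def)
    then show ?thesis
      by (rule Bochner_Integration.integrable_cong[THEN iffD1, rotated -1])
         (use assms(6) in \<open>auto simp: \<psi>_def M_def\<close>)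
  qed
  \<comment> \<open>Only \<open>\<psi>\<close> is known to be integrable so far. On a disc of radius
    \<open>r < 1\<close> the other two functions are integrable as well, so the three integrals can
    be compared there.\<close>
  have "integrable M \<phi> \<and> (\<integral>z. \<phi> z \<partial>M) \<le> (\<integral>z. \<psi> z \<partial>M) / C powr (p / 2)"
    unfolding M_def
  proof (rule unit_disc_exhaustion[OF cont(1) _ assms(2)])
    fix r :: real assume r: "r < 1"
    note int = integrable_weighted_area_ball[OF _ assms(2) r, folded M_def]
    have "0 \<le> (\<integral>z. indicator (ball 0 r) z * v (h z * g z) \<partial>M)"
      unfolding M_def using assms(7)
      by (intro weighted_integral_nonneg v(1-3) holomorphic_intros hol assms(2) r v(4)) (simp add: mult.commute)
    then have "(\<integral>z. indicator (ball 0 r) z * \<phi> z \<partial>M)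
        \<le> (\<integral>z. indicator (ball 0 r) z * \<phi> z \<partial>M) + (\<integral>z. indicator (ball 0 r) z * v (h z * g z) \<partial>M)"
      by simp
    also have "\<dots> = (\<integral>z. indicator (ball 0 r) z * \<phi> z + indicator (ball 0 r) z * v (h z * g z) \<partial>M)"
      by (rule Bochner_Integration.integral_add[symmetric]) (intro int cont)+
    \<comment> \<open>Outside the smaller disc the left integrand is 0 and \<open>\<psi>\<close> is
      nonnegative, so the bound uses the full integral of \<open>\<psi>\<close> and does not depend
      on \<open>r\<close>.\<close>
    also have "\<dots> \<le> (\<integral>z. \<psi> z / C powr (p / 2) \<partial>M)"
    proof (rule integral_mono)
      show "integrable M (\<lambda>z. indicator (ball 0 r) z * \<phi> z + indicator (ball 0 r) z * v (h z * g z))"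
        by (intro Bochner_Integration.integrable_add int cont)
      show "integrable M (\<lambda>z. \<psi> z / C powr (p / 2))" using int\<psi> by simp
      show "indicator (ball 0 r) z * \<phi> z + indicator (ball 0 r) z * v (h z * g z) \<le> \<psi> z / C powr (p / 2)" for z
        using v(5)[of "h z" "g z"] by (auto simp: indicator_def \<phi>_def \<psi>_def)
    qed
    finally show "(\<integral>z. indicator (ball 0 r) z * \<phi> z \<partial>weighted_area \<alpha>)
        \<le> (\<integral>z. \<psi> z \<partial>weighted_area \<alpha>) / C powr (p / 2)"
      by (simp add: M_def)
  qed (simp add: \<phi>_def)
  moreover from this have "(\<integral>z. \<phi> z \<partial>M) powr (1 / p) \<le> ((\<integral>z. \<psi> z \<partial>M) / C powr (p / 2)) powr (1 / p)"
    using assms(1) by (intro powr_mono2 Bochner_Integration.integral_nonneg) (auto simp: \<phi>_def)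
  moreover have "((\<integral>z. \<psi> z \<partial>M) / C powr (p / 2)) powr (1 / p) = 1 / C powr (1 / 2) * (\<integral>z. \<psi> z \<partial>M) powr (1 / p)"
    using C assms(1) by (simp add: powr_divide powr_powr Bochner_Integration.integral_nonneg \<psi>_def)
  ultimately show ?thesis unfolding \<phi>_def[abs_def] \<psi>_def M_def C_def by simp
qed

end
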